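(* Let $K$ be a field and $S=K[x_1,\ldots,x_n]$. Let $q\geq p$ be positive integers, and let $u_1,\ldots,u_q\in S$ and $v_1,\ldots,v_p\in S$ be two regular sequences of monomials on $S$ with $u_i\mid v_i$ for all $1\leq i\leq p$. Consider the monomial ideals $J=(u_1,\ldots,u_q)\subset S$ and $I=(v_1,\ldots,v_p)\subset S$, and suppose $I\neq J$. Assume also that $u_{p+1},\ldots,u_q$ is a regular sequence on $S/I$ (an empty condition if $q=p$). Then $$\operatorname{sdepth}_S(J/I)=n-p-\left\lfloor\frac{q-p}{2}\right\rfloor.$$
   Context: Let $S=K[x_1,\ldots,x_n]$ with its standard $\mathbb Z^n$-grading and let $M\neq 0$ be a $\mathbb Z^n$-graded $S$-module. A Stanley decomposition of $M$ is a finite direct sum decomposition $\mathcal D: M=\bigoplus_{i=1}^r m_iK[Z_i]$ as a $\mathbb Z^n$-graded $K$-vector space, where each $m_i\in M$ is homogeneous with respect to the $\mathbb Z^n$-grading, $Z_i\subset\{x_1,\ldots,x_n\}$, and $m_iK[Z_i]=\{um_i: u\in K[Z_i]\}\subset M$ is a free $K[Z_i]$-submodule of $M$. Put $\operatorname{sdepth}(\mathcal D)=\min_{i}|Z_i|$ and $\operatorname{sdepth}_S(M)=\max\{\operatorname{sdepth}(\mathcal D): \mathcal D \text{ is a Stanley decomposition of } M\}$; this is the Stanley depth of $M$. *)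

theory Defs
  imports "HOL-Algebra.Algebraic_Closure_Type" "HOL-Library.Poly_Mapping" "HOL-Library.Cardinality"
begin

text \<open>
  The polynomial ring \<open>S = K[x\<^sub>1, \<dots>, x\<^sub>n]\<close> is the type of finitely supported maps from exponent
  vectors to \<open>K\<close>. The variables are indexed by a finite type \<open>'n\<close>, so \<open>n = CARD('n)\<close>.
\<close>

type_synonym ('n, 'k) mpoly = "('n \<Rightarrow>\<^sub>0 nat) \<Rightarrow>\<^sub>0 'k"

definition is_monomial :: "('n, 'k::zero_neq_one) mpoly \<Rightarrow> bool" where
  "is_monomial f \<longleftrightarrow> (\<exists>a. f = Poly_Mapping.single a 1)"

text \<open>The subalgebra \<open>K[Z]\<close> for a set \<open>Z\<close> of variables.\<close>

definition subvar_polys :: "'n set \<Rightarrow> ('n, 'k::zero) mpoly set" where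
  "subvar_polys Z = {u. \<forall>a\<in>Poly_Mapping.keys u. Poly_Mapping.keys a \<subseteq> Z}"

text \<open>The component of \<open>S\<close> of degree \<open>d \<in> \<int>\<^sup>n\<close>; it is \<open>0\<close> if \<open>d\<close> has a negative entry.\<close>

definition mpoly_component :: "('n \<Rightarrow> int) \<Rightarrow> ('n, 'k::zero) mpoly set" where
  "mpoly_component d =
     {f. \<forall>a\<in>Poly_Mapping.keys f. \<forall>i. int (Poly_Mapping.lookup a i) = d i}"

text \<open>
  HOL-Algebra modules are records extending rings; the fields \<open>mult\<close> and \<open>one\<close> play no role
  for a module and are left undefined below.
\<close>

definition ideal_module :: "'a::comm_ring_1 set \<Rightarrow> ('a, 'a) module" where
  "ideal_module J =
     \<lparr>carrier = J, monoid.mult = undefined, one = undefined, zero = 0, add = (+), module.smult = (*)\<rparr>"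

definition quot_module :: "('a, 'm, 'z) module_scheme \<Rightarrow> 'm set \<Rightarrow> ('a, 'm set) module" where
  "quot_module M N =
     \<lparr>carrier = a_rcosets\<^bsub>M\<^esub> N, monoid.mult = undefined, one = undefined, zero = N, add = (<+>\<^bsub>M\<^esub>),
      module.smult = (\<lambda>f A. \<Union>x\<in>A. N +>\<^bsub>M\<^esub> (f \<odot>\<^bsub>M\<^esub> x))\<rparr>"

text \<open>
  For ideals \<open>I \<subseteq> J\<close> of \<open>S\<close>: the module \<open>J/I\<close> and its \<open>\<int>\<^sup>n\<close>-grading. In particular \<open>J = UNIV\<close>
  gives \<open>S/I\<close>.
\<close>

definition ideal_quot :: "'a::comm_ring_1 set \<Rightarrow> 'a set \<Rightarrow> ('a, 'a set) module" where
  "ideal_quot J I = quot_module (ideal_module J) I"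

definition ideal_quot_grading ::
    "('n, 'k::field) mpoly set \<Rightarrow> ('n, 'k) mpoly set \<Rightarrow> ('n \<Rightarrow> int) \<Rightarrow> ('n, 'k) mpoly set set" where
  "ideal_quot_grading J I d = (\<lambda>f. I +>\<^bsub>ideal_module J\<^esub> f) ` (J \<inter> mpoly_component d)"

text \<open>\<open>(f\<^sub>1, \<dots>, f\<^sub>r) M\<close>\<close>

definition list_multiples :: "('a, 'm, 'z) module_scheme \<Rightarrow> 'a list \<Rightarrow> 'm set" where
  "list_multiples M fs =
     {\<Oplus>\<^bsub>M\<^esub>i\<in>{..<length fs}. (fs ! i) \<odot>\<^bsub>M\<^esub> h i | h. h \<in> {..<length fs} \<rightarrow> carrier M}"

definition nonzerodivisor_on :: "('a, 'm, 'z) module_scheme \<Rightarrow> 'a \<Rightarrow> bool" where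
  "nonzerodivisor_on M f \<longleftrightarrow> (\<forall>x\<in>carrier M. f \<odot>\<^bsub>M\<^esub> x = \<zero>\<^bsub>M\<^esub> \<longrightarrow> x = \<zero>\<^bsub>M\<^esub>)"

text \<open>
  \<open>f\<^sub>1, \<dots>, f\<^sub>r\<close> is \<open>M\<close>-regular: each \<open>f\<^sub>i\<close> is a nonzerodivisor on \<open>M/(f\<^sub>1, \<dots>, f\<^bsub>i-1\<^esub>)M\<close>, and
  \<open>M/(f\<^sub>1, \<dots>, f\<^sub>r)M \<noteq> 0\<close>.
\<close>

definition regular_sequence :: "('a, 'm, 'z) module_scheme \<Rightarrow> 'a list \<Rightarrow> bool" where
  "regular_sequence M fs \<longleftrightarrow>
     (\<forall>i<length fs. nonzerodivisor_on (quot_module M (list_multiples M (take i fs))) (fs ! i)) \<and>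
     carrier (quot_module M (list_multiples M fs)) \<noteq> {\<zero>\<^bsub>quot_module M (list_multiples M fs)\<^esub>}"

text \<open>
  \<open>\<int>\<^sup>n\<close>-graded \<open>S\<close>-modules: \<open>M\<close> is the internal direct sum of the \<open>G d\<close>, and
  \<open>S\<^sub>e \<cdot> G d \<subseteq> G (e + d)\<close>.
\<close>

locale multigraded_module =
  module "ring_of_type_algebra :: ('n, 'k::field) mpoly ring" M
  for M :: "(('n, 'k::field) mpoly, 'm, 'z) module_scheme" (structure) +
  fixes G :: "('n \<Rightarrow> int) \<Rightarrow> 'm set"
  assumes component_subgroup: "additive_subgroup (G d) M"
    and component_smult: "f \<in> mpoly_component e \<Longrightarrow> x \<in> G d \<Longrightarrow> f \<odot>\<^bsub>M\<^esub> x \<in> G (\<lambda>i. e i + d i)"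
    and component_decomp: "x \<in> carrier M \<Longrightarrow>
      \<exists>!h. (\<forall>d. h d \<in> G d) \<and> finite {d. h d \<noteq> \<zero>\<^bsub>M\<^esub>} \<and> x = (\<Oplus>\<^bsub>M\<^esub>d\<in>{d. h d \<noteq> \<zero>\<^bsub>M\<^esub>}. h d)"

text \<open>\<open>m K[Z]\<close>\<close>

definition stanley_space ::
    "(('n, 'k::zero) mpoly, 'm, 'z) module_scheme \<Rightarrow> 'm \<Rightarrow> 'n set \<Rightarrow> 'm set" where
  "stanley_space M m Z = {u \<odot>\<^bsub>M\<^esub> m | u. u \<in> subvar_polys Z}"

text \<open>
  A Stanley decomposition of \<open>M\<close> (with grading \<open>G\<close>) is a list of pairs \<open>(m\<^sub>i, Z\<^sub>i)\<close>. The third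
  conjunct says that \<open>m\<^sub>i\<close> is a basis of \<open>m\<^sub>i K[Z\<^sub>i]\<close> over \<open>K[Z\<^sub>i]\<close>; in particular \<open>m\<^sub>i \<noteq> 0\<close>. The
  last one says that \<open>M\<close> is the direct sum of the \<open>m\<^sub>i K[Z\<^sub>i]\<close>; as the \<open>m\<^sub>i\<close> are homogeneous,
  these are graded subspaces.
\<close>

definition stanley_decomposition ::
    "(('n::finite, 'k::field) mpoly, 'm, 'z) module_scheme \<Rightarrow> (('n \<Rightarrow> int) \<Rightarrow> 'm set) \<Rightarrow>
     ('m \<times> 'n set) list \<Rightarrow> bool" where
  "stanley_decomposition M G D \<longleftrightarrow>
     (\<forall>(m, Z)\<in>set D. m \<in> carrier M \<and> (\<exists>d. m \<in> G d) \<and>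
        (\<forall>u\<in>subvar_polys Z. u \<odot>\<^bsub>M\<^esub> m = \<zero>\<^bsub>M\<^esub> \<longrightarrow> u = 0)) \<and>
     (\<forall>x\<in>carrier M. \<exists>!s. s \<in> (\<Pi>\<^sub>E i\<in>{..<length D}. stanley_space M (fst (D ! i)) (snd (D ! i))) \<and>
        x = (\<Oplus>\<^bsub>M\<^esub>i\<in>{..<length D}. s i))"

text \<open>For \<open>M \<noteq> 0\<close> every Stanley decomposition is nonempty.\<close>

definition sdepth_decomp :: "('m \<times> 'n set) list \<Rightarrow> nat" where
  "sdepth_decomp D = Min ((\<lambda>(m, Z). card Z) ` set D)"

definition sdepth ::
    "(('n::finite, 'k::field) mpoly, 'm, 'z) module_scheme \<Rightarrow> (('n \<Rightarrow> int) \<Rightarrow> 'm set) \<Rightarrow> nat" where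
  "sdepth M G = Max {sdepth_decomp D | D. stanley_decomposition M G D}"

text \<open>For monomial ideals \<open>I \<subseteq> J\<close>, this does make \<open>J/I\<close> a \<open>\<int>\<^sup>n\<close>-graded \<open>S\<close>-module.\<close>

lemma ideal_of_typeD:
  assumes "ideal I (ring_of_type_algebra :: 'a::comm_ring_1 ring)"
  shows "0 \<in> I" "x \<in> I \<Longrightarrow> y \<in> I \<Longrightarrow> x + y \<in> I" "x \<in> I \<Longrightarrow> f * x \<in> I"
    "x \<in> I \<Longrightarrow> - x \<in> I" "x \<in> I \<Longrightarrow> y \<in> I \<Longrightarrow> x - y \<in> I"
proof -
  interpret ideal I "ring_of_type_algebra :: 'a ring" by fact
  show 0: "0 \<in> I" using additive_subgroup.zero_closed[OF is_additive_subgroup]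
    by (simp add: ring_of_type_algebra_def)
  show a: "x + y \<in> I" if "x \<in> I" "y \<in> I" for x y
    using additive_subgroup.a_closed[OF is_additive_subgroup that]
    by (simp add: ring_of_type_algebra_def)
  show m: "f * x \<in> I" if "x \<in> I" for f x
    using I_l_closed[OF that, of f] by (simp add: ring_of_type_algebra_def)
  show n: "- x \<in> I" if "x \<in> I" for x using m[OF that, of "-1"] by simp
  show "x - y \<in> I" if "x \<in> I" "y \<in> I" for x y using a[OF that(1) n[OF that(2)]] by simp
qed

lemma genideal_monomials_term:
  fixes U :: "('n, 'k::field) mpoly set"
  assumes "\<forall>u\<in>U. is_monomial u" "f \<in> genideal ring_of_type_algebra U"
  shows "Poly_Mapping.single a (Poly_Mapping.lookup f a) \<in> genideal ring_of_type_algebra U"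
    (is "_ \<in> ?I")
proof -
  let ?R = "ring_of_type_algebra :: ('n, 'k) mpoly ring"
  interpret R: cring ?R by (rule cring_from_type_algebra)
  have I: "ideal ?I ?R" by (rule R.genideal_ideal) (simp add: ring_of_type_algebra_def)
  note ID = ideal_of_typeD[OF I]
  define T where "T = {f. \<forall>g a. Poly_Mapping.single a (Poly_Mapping.lookup (g * f) a) \<in> ?I}"
  have T: "ideal T ?R"
  proof (rule idealI)
    show "ring ?R" by (rule R.ring_axioms)
    show "subgroup T (add_monoid ?R)"
    proof (rule group.subgroupI[OF R.a_group])
      have "0 \<in> T" using ID(1) by (auto simp: T_def)
      then show "T \<noteq> {}" by auto
      fix x y assume x: "x \<in> T" and y: "y \<in> T"
      have "- x \<in> T" unfolding T_def
        using x by (auto simp: T_def intro: ID(4) simp: lookup_uminus single_uminus)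
      have "inv\<^bsub>add_monoid ?R\<^esub> x = - x"
        by (rule group.inv_equality[OF R.a_group]) (auto simp: ring_of_type_algebra_def)
      then show "inv\<^bsub>add_monoid ?R\<^esub> x \<in> T" using \<open>- x \<in> T\<close> by simp
      have "x + y \<in> T" unfolding T_def
      proof (intro CollectI allI)
        fix g a
        have "Poly_Mapping.single a (Poly_Mapping.lookup (g * x) a) \<in> ?I"
          "Poly_Mapping.single a (Poly_Mapping.lookup (g * y) a) \<in> ?I"
          using x y unfolding T_def by blast+
        then show "Poly_Mapping.single a (Poly_Mapping.lookup (g * (x + y)) a) \<in> ?I"
          unfolding distrib_left lookup_add single_add by (rule ID(2))
      qed
      then show "x \<otimes>\<^bsub>add_monoid ?R\<^esub> y \<in> T" by (simp add: ring_of_type_algebra_def)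
    qed (simp add: ring_of_type_algebra_def)
    fix x y assume x: "x \<in> T"
    have "y * x \<in> T" unfolding T_def
    proof (intro CollectI allI)
      fix g a
      show "Poly_Mapping.single a (Poly_Mapping.lookup (g * (y * x)) a) \<in> ?I"
        using x unfolding T_def mult.assoc[symmetric] by blast
    qed
    then show "y \<otimes>\<^bsub>?R\<^esub> x \<in> T" "x \<otimes>\<^bsub>?R\<^esub> y \<in> T"
      by (simp_all add: ring_of_type_algebra_def mult.commute)
  qed
  have "U \<subseteq> T"
  proof
    fix u assume u: "u \<in> U"
    then obtain b where b: "u = Poly_Mapping.single b 1" using assms(1) by (auto simp: is_monomial_def)
    have uI: "u \<in> ?I" using u R.genideal_self[of U] by (auto simp: ring_of_type_algebra_def)
    show "u \<in> T" unfolding T_def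
    proof (intro CollectI allI)
      fix g :: "('n, 'k) mpoly" and a
      show "Poly_Mapping.single a (Poly_Mapping.lookup (g * u) a) \<in> ?I"
      proof (cases "a \<in> Poly_Mapping.keys (g * u)")
        case True
        then obtain e where "a = e + b" using keys_mult[of g u] by (auto simp: b split: if_splits)
        then have "Poly_Mapping.single a (Poly_Mapping.lookup (g * u) a) =
            Poly_Mapping.single e (Poly_Mapping.lookup (g * u) a) * u"
          by (simp add: b mult_single)
        then show ?thesis using ID(3)[OF uI] by simp
      next
        case False
        then show ?thesis using ID(1) by (simp add: in_keys_iff)
      qed
    qed
  qed
  then have "f \<in> T" using assms(2) R.genideal_minimal[OF T] by auto
  then show ?thesis unfolding T_def by (auto dest: spec[of _ 1])
qed

locale ideal_pair =
  fixes I J :: "'a::comm_ring_1 set"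
  assumes I: "ideal I (ring_of_type_algebra :: 'a ring)" and J: "ideal J (ring_of_type_algebra :: 'a ring)" and IJ: "I \<subseteq> J"
begin

abbreviation c where "c f \<equiv> I +>\<^bsub>ideal_module J\<^esub> f"

lemma coset: "c f = (\<lambda>h. h + f) ` I"
  by (auto simp: a_r_coset_def r_coset_def ideal_module_def)

lemma coset_eq: "c f = c g \<longleftrightarrow> f - g \<in> I"
proof
  assume "c f = c g"
  then have "f \<in> c g" using ideal_of_typeD(1)[OF I] unfolding coset by force
  then show "f - g \<in> I" by (auto simp: coset)
next
  assume *: "f - g \<in> I"
  have "c f \<subseteq> c g" if "f - g \<in> I" for f g
  proof
    fix x assume "x \<in> c f"
    then obtain h where "h \<in> I" "x = h + f" by (auto simp: coset)
    then have "x = (h + (f - g)) + g" "h + (f - g) \<in> I" using that ideal_of_typeD(2)[OF I] by auto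
    then show "x \<in> c g" unfolding coset by blast
  qed
  from this[OF *] this[of g f] ideal_of_typeD(4)[OF I *] show "c f = c g" by auto
qed

lemma coset_0: "c 0 = I" by (auto simp: coset)
lemma coset_I: "c f = I \<longleftrightarrow> f \<in> I" using coset_eq[of f 0] by (simp add: coset_0)

lemma carrier_quot: "carrier (ideal_quot J I) = c ` J"
  by (auto simp: ideal_quot_def quot_module_def A_RCOSETS_def RCOSETS_def a_r_coset_def ideal_module_def)

lemma zero_quot: "\<zero>\<^bsub>ideal_quot J I\<^esub> = c 0"
  by (simp add: coset_0) (simp add: ideal_quot_def quot_module_def)

lemma add_quot: "c f \<oplus>\<^bsub>ideal_quot J I\<^esub> c g = c (f + g)"
proof -
  have "c f \<oplus>\<^bsub>ideal_quot J I\<^esub> c g = {x + y | x y. x \<in> c f \<and> y \<in> c g}"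
    by (auto simp: ideal_quot_def quot_module_def set_add_def set_mult_def ideal_module_def)
  also have "\<dots> = c (f + g)"
  proof safe
    fix x y assume "x \<in> c f" "y \<in> c g"
    then obtain h k where "h \<in> I" "k \<in> I" "x = h + f" "y = k + g" by (auto simp: coset)
    then have "x + y = (h + k) + (f + g)" "h + k \<in> I" using ideal_of_typeD(2)[OF I] by auto
    then show "x + y \<in> c (f + g)" unfolding coset by blast
  next
    fix x assume "x \<in> c (f + g)"
    then obtain h where h: "h \<in> I" "x = h + (f + g)" by (auto simp: coset)
    then have "x = (h + f) + (0 + g)" "h + f \<in> c f" "0 + g \<in> c g"
      using ideal_of_typeD(1)[OF I] unfolding coset by auto
    then show "\<exists>y z. x = y + z \<and> y \<in> c f \<and> z \<in> c g" by blast
  qed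
  finally show ?thesis .
qed

lemma smult_quot: "g \<odot>\<^bsub>ideal_quot J I\<^esub> c f = c (g * f)"
proof -
  have "g \<odot>\<^bsub>ideal_quot J I\<^esub> c f = (\<Union>x\<in>c f. c (g * x))"
    by (simp add: ideal_quot_def quot_module_def) (simp add: ideal_module_def)
  also have "\<dots> = c (g * f)"
  proof -
    have "c (g * x) = c (g * f)" if "x \<in> c f" for x
    proof -
      from that obtain h where "h \<in> I" "x = h + f" by (auto simp: coset)
      then show ?thesis unfolding coset_eq using ideal_of_typeD(3)[OF I, of h g] by (simp add: algebra_simps)
    qed
    moreover have "f \<in> c f" unfolding coset using ideal_of_typeD(1)[OF I] by force
    ultimately show ?thesis by blast
  qed
  finally show ?thesis .
qed

lemma module_quot: "module ring_of_type_algebra (ideal_quot J I)"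
proof (rule moduleI)
  note JD = ideal_of_typeD[OF J]
  show "cring (ring_of_type_algebra :: 'a ring)" by (rule cring_from_type_algebra)
  show "abelian_group (ideal_quot J I)"
  proof (rule abelian_groupI)
    fix x assume "x \<in> carrier (ideal_quot J I)"
    then obtain f where f: "f \<in> J" "x = c f" by (auto simp: carrier_quot)
    then show "\<exists>y\<in>carrier (ideal_quot J I). y \<oplus>\<^bsub>ideal_quot J I\<^esub> x = \<zero>\<^bsub>ideal_quot J I\<^esub>"
      by (intro bexI[of _ "c (- f)"]) (auto simp: add_quot zero_quot carrier_quot JD)
  qed (auto simp: carrier_quot add_quot zero_quot algebra_simps JD)
qed (auto simp: carrier_quot add_quot zero_quot smult_quot algebra_simps ring_of_type_algebra_def
        ideal_of_typeD[OF J])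

lemma finsum_quot:
  assumes "finite A" "\<And>i. i \<in> A \<Longrightarrow> f i \<in> J"
  shows "(\<Oplus>\<^bsub>ideal_quot J I\<^esub>i\<in>A. c (f i)) = c (\<Sum>i\<in>A. f i)"
proof -
  interpret M: module ring_of_type_algebra "ideal_quot J I" by (rule module_quot)
  show ?thesis using assms
  proof (induction A rule: finite_induct)
    case empty show ?case by (simp add: zero_quot)
  next
    case (insert x F)
    then have "(\<Oplus>\<^bsub>ideal_quot J I\<^esub>i\<in>insert x F. c (f i)) = c (f x) \<oplus>\<^bsub>ideal_quot J I\<^esub> (\<Oplus>\<^bsub>ideal_quot J I\<^esub>i\<in>F. c (f i))"
      by (intro M.M.finsum_insert) (auto simp: carrier_quot)
    with insert show ?case by (simp add: add_quot)
  qed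
qed

end


lemma mpoly_component_0: "0 \<in> mpoly_component d"
  by (simp add: mpoly_component_def)

lemma mpoly_component_add:
  "f \<in> mpoly_component d \<Longrightarrow> g \<in> mpoly_component d \<Longrightarrow> f + g \<in> mpoly_component d"
  using Poly_Mapping.keys_add[of f g] by (auto simp: mpoly_component_def)

lemma mpoly_component_uminus:
  fixes f :: "('n, 'k::field) mpoly"
  shows "f \<in> mpoly_component d \<Longrightarrow> - f \<in> mpoly_component d"
  by (auto simp: mpoly_component_def in_keys_iff lookup_uminus)

lemma mpoly_component_mult:
  fixes f :: "('n, 'k::field) mpoly"
  assumes "f \<in> mpoly_component e" "g \<in> mpoly_component d"
  shows "f * g \<in> mpoly_component (\<lambda>i. e i + d i)"
  unfolding mpoly_component_def
proof safe
  fix a i assume "a \<in> Poly_Mapping.keys (f * g)"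
  then obtain b b' where "a = b + b'" "b \<in> Poly_Mapping.keys f" "b' \<in> Poly_Mapping.keys g"
    using keys_mult[of f g] by blast
  then show "int (Poly_Mapping.lookup a i) = e i + d i"
    using assms by (auto simp: mpoly_component_def lookup_add)
qed

definition deg_of :: "('n \<Rightarrow>\<^sub>0 nat) \<Rightarrow> 'n \<Rightarrow> int" where
  "deg_of a = (\<lambda>i. int (Poly_Mapping.lookup a i))"

lemma deg_of_inj: "deg_of a = deg_of b \<longleftrightarrow> a = b"
  by (auto simp: deg_of_def fun_eq_iff intro: poly_mapping_eqI)

lemma mpoly_component_deg_of:
  "f \<in> mpoly_component (deg_of a) \<longleftrightarrow> (\<exists>v. f = Poly_Mapping.single a v)"
proof
  assume "f \<in> mpoly_component (deg_of a)"
  then have "\<forall>b\<in>Poly_Mapping.keys f. deg_of b = deg_of a"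
    by (auto simp: mpoly_component_def deg_of_def)
  then have "Poly_Mapping.keys f \<subseteq> {a}" by (auto simp: deg_of_inj)
  then have "f = Poly_Mapping.single a (Poly_Mapping.lookup f a)"
    by (intro poly_mapping_eqI) (auto simp: lookup_single when_def in_keys_iff)
  then show "\<exists>v. f = Poly_Mapping.single a v" ..
qed (auto simp: mpoly_component_def deg_of_def split: if_splits)

lemma mpoly_component_not_deg_of:
  "d \<notin> range deg_of \<Longrightarrow> f \<in> mpoly_component d \<Longrightarrow> f = 0"
proof (rule ccontr)
  assume *: "d \<notin> range deg_of" "f \<in> mpoly_component d" "f \<noteq> 0"
  then obtain a where "a \<in> Poly_Mapping.keys f" using keys_eq_empty[of f] by blast
  then have "d = deg_of a" using *(2) by (auto simp: mpoly_component_def deg_of_def)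
  then show False using *(1) by blast
qed

lemma sum_single_keys:
  fixes f :: "('n, 'k::field) mpoly"
  shows "(\<Sum>a\<in>Poly_Mapping.keys f. Poly_Mapping.single a (Poly_Mapping.lookup f a)) = f"
  by (intro poly_mapping_eqI) (auto simp: lookup_sum lookup_single when_def in_keys_iff sum.delta)

lemma lookup_hom_sum:
  fixes g :: "('n \<Rightarrow> int) \<Rightarrow> ('n, 'k::field) mpoly"
  assumes "finite A" "\<And>d. g d \<in> mpoly_component d" "\<And>d. d \<notin> A \<Longrightarrow> g d = 0"
  shows "g (deg_of a) = Poly_Mapping.single a (Poly_Mapping.lookup (\<Sum>d\<in>A. g d) a)"
proof -
  have *: "Poly_Mapping.lookup (g d) a = (Poly_Mapping.lookup (g (deg_of a)) a when d = deg_of a)" for d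
  proof (cases "d = deg_of a")
    case False
    then have "a \<notin> Poly_Mapping.keys (g d)" using assms(2)[of d] by (auto simp: mpoly_component_def deg_of_def)
    with False show ?thesis by (simp add: in_keys_iff)
  qed simp
  have "Poly_Mapping.lookup (\<Sum>d\<in>A. g d) a = (\<Sum>d\<in>A. Poly_Mapping.lookup (g d) a)"
    by (simp add: lookup_sum)
  also have "\<dots> = Poly_Mapping.lookup (g (deg_of a)) a"
    using assms(1,3) by (subst *) (auto simp: when_def sum.delta)
  finally show ?thesis using assms(2)[of "deg_of a"] by (auto simp: mpoly_component_deg_of)
qed

lemma multigraded_module_monomial_quot:
  fixes U V :: "('n, 'k::field) mpoly set"
  assumes "\<forall>u\<in>U. is_monomial u" "\<forall>v\<in>V. is_monomial v"
    and Jdef: "J = genideal ring_of_type_algebra U" and Idef: "I = genideal ring_of_type_algebra V"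
    and "I \<subseteq> J"
  shows "multigraded_module (ideal_quot J I) (ideal_quot_grading J I)"
proof -
  interpret R: cring "ring_of_type_algebra :: ('n, 'k) mpoly ring" by (rule cring_from_type_algebra)
  have I: "ideal I ring_of_type_algebra" and J: "ideal J ring_of_type_algebra"
    unfolding Idef Jdef by (rule R.genideal_ideal, simp add: ring_of_type_algebra_def)+
  interpret ideal_pair I J by (rule ideal_pair.intro[OF I J \<open>I \<subseteq> J\<close>])
  interpret M: module ring_of_type_algebra "ideal_quot J I" by (rule module_quot)
  note ID = ideal_of_typeD[OF I] and JD = ideal_of_typeD[OF J]
  have It: "Poly_Mapping.single a (Poly_Mapping.lookup f a) \<in> I" if "f \<in> I" for f a
    using genideal_monomials_term[OF assms(2)] that by (auto simp: Idef)
  have Jt: "Poly_Mapping.single a (Poly_Mapping.lookup f a) \<in> J" if "f \<in> J" for f a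
    using genideal_monomials_term[OF assms(1)] that by (auto simp: Jdef)
  show ?thesis
  proof (intro multigraded_module.intro multigraded_module_axioms.intro module_quot)
    fix d :: "'n \<Rightarrow> int"
    show "additive_subgroup (ideal_quot_grading J I d) (ideal_quot J I)"
    proof (rule additive_subgroup.intro)
      show "subgroup (ideal_quot_grading J I d) (add_monoid (ideal_quot J I))"
      proof (rule group.subgroupI[OF M.M.a_group])
        show "ideal_quot_grading J I d \<subseteq> carrier (add_monoid (ideal_quot J I))"
          by (auto simp: ideal_quot_grading_def carrier_quot)
        show "ideal_quot_grading J I d \<noteq> {}"
          using JD(1) mpoly_component_0 by (auto simp: ideal_quot_grading_def)
        fix x y assume "x \<in> ideal_quot_grading J I d"
        then obtain f where f: "x = c f" "f \<in> J" "f \<in> mpoly_component d"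
          by (auto simp: ideal_quot_grading_def)
        have "inv\<^bsub>add_monoid (ideal_quot J I)\<^esub> x = c (- f)"
          by (rule group.inv_equality[OF M.M.a_group])
             (use f JD in \<open>auto simp: add_quot zero_quot carrier_quot\<close>)
        then show "inv\<^bsub>add_monoid (ideal_quot J I)\<^esub> x \<in> ideal_quot_grading J I d"
          unfolding ideal_quot_grading_def using f(2,3) by (auto intro!: imageI JD(4) mpoly_component_uminus)
        assume "y \<in> ideal_quot_grading J I d"
        then obtain g where g: "y = c g" "g \<in> J" "g \<in> mpoly_component d"
          by (auto simp: ideal_quot_grading_def)
        have "x \<otimes>\<^bsub>add_monoid (ideal_quot J I)\<^esub> y = c (f + g)"
          using f g by (simp add: add_quot)
        then show "x \<otimes>\<^bsub>add_monoid (ideal_quot J I)\<^esub> y \<in> ideal_quot_grading J I d"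
          unfolding ideal_quot_grading_def using f(2,3) g(2,3) by (auto intro!: imageI JD(2) mpoly_component_add)
      qed
    qed
    fix f :: "('n, 'k) mpoly" and e x
    assume "f \<in> mpoly_component e" "x \<in> ideal_quot_grading J I d"
    then show "f \<odot>\<^bsub>ideal_quot J I\<^esub> x \<in> ideal_quot_grading J I (\<lambda>i. e i + d i)"
      by (auto simp: ideal_quot_grading_def smult_quot intro!: imageI JD(3) mpoly_component_mult)
  next
    fix x assume "x \<in> carrier (ideal_quot J I)"
    then obtain f where f: "f \<in> J" "x = c f" by (auto simp: carrier_quot)
    let ?P = "\<lambda>h. (\<forall>d. h d \<in> ideal_quot_grading J I d) \<and>
       finite {d. h d \<noteq> \<zero>\<^bsub>ideal_quot J I\<^esub>} \<and>
       x = (\<Oplus>\<^bsub>ideal_quot J I\<^esub>d\<in>{d. h d \<noteq> \<zero>\<^bsub>ideal_quot J I\<^esub>}. h d)"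
    define t where "t = (\<lambda>d. if d \<in> range deg_of then
       Poly_Mapping.single (inv_into UNIV deg_of d) (Poly_Mapping.lookup f (inv_into UNIV deg_of d)) else 0)"
    have inj: "inj deg_of" by (auto simp: inj_def deg_of_inj)
    have t1: "t (deg_of a) = Poly_Mapping.single a (Poly_Mapping.lookup f a)" for a
      by (simp add: t_def inv_f_f[OF inj])
    have t2: "t d = 0" if "d \<notin> range deg_of" for d using that by (simp add: t_def)
    have tJ: "t d \<in> J" for d using Jt[OF f(1)] JD(1) by (simp add: t_def)
    have tc: "t d \<in> mpoly_component d" for d
    proof (cases "d \<in> range deg_of")
      case True then show ?thesis by (auto simp: t1 mpoly_component_deg_of)
    qed (simp add: t2 mpoly_component_0)
    have tsum: "(\<Sum>d\<in>deg_of ` Poly_Mapping.keys f. t d) = f"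
      by (subst sum.reindex) (use inj in \<open>auto simp: inj_def inj_on_def t1 sum_single_keys\<close>)
    define h where "h = (\<lambda>d. c (t d))"
    have sub: "{d. h d \<noteq> \<zero>\<^bsub>ideal_quot J I\<^esub>} \<subseteq> deg_of ` Poly_Mapping.keys f"
    proof
      fix d assume "d \<in> {d. h d \<noteq> \<zero>\<^bsub>ideal_quot J I\<^esub>}"
      then have "t d \<noteq> 0" by (auto simp: h_def zero_quot)
      then show "d \<in> deg_of ` Poly_Mapping.keys f" by (cases "d \<in> range deg_of") (auto simp: t1 t2 in_keys_iff intro!: imageI)
    qed
    have fin: "finite {d. h d \<noteq> \<zero>\<^bsub>ideal_quot J I\<^esub>}" using sub by (rule finite_subset) simp
    have hsum: "(\<Oplus>\<^bsub>ideal_quot J I\<^esub>d\<in>{d. h d \<noteq> \<zero>\<^bsub>ideal_quot J I\<^esub>}. h d) =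
        (\<Oplus>\<^bsub>ideal_quot J I\<^esub>d\<in>deg_of ` Poly_Mapping.keys f. h d)"
      by (rule M.M.add.finprod_mono_neutral_cong_left)
         (use sub tJ in \<open>simp_all add: h_def carrier_quot subset_iff\<close>, blast?)
    show "\<exists>!h. ?P h"
    proof (rule ex1I[of _ h])
      have "\<forall>d. h d \<in> ideal_quot_grading J I d"
        using tc tJ unfolding h_def ideal_quot_grading_def by blast
      moreover have "x = (\<Oplus>\<^bsub>ideal_quot J I\<^esub>d\<in>deg_of ` Poly_Mapping.keys f. h d)"
        using finsum_quot[of "deg_of ` Poly_Mapping.keys f" t] tJ unfolding tsum h_def f(2) by simp
      ultimately show "?P h" using fin hsum by metis
    next
      fix k assume k: "?P k"
      have "\<exists>g. g \<in> J \<and> g \<in> mpoly_component d \<and> k d = c g \<and> (k d = \<zero>\<^bsub>ideal_quot J I\<^esub> \<longrightarrow> g = 0)" for d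
      proof (cases "k d = \<zero>\<^bsub>ideal_quot J I\<^esub>")
        case True
        then show ?thesis using JD(1) mpoly_component_0[of d] zero_quot by metis
      next
        case False
        have "k d \<in> ideal_quot_grading J I d" using k by blast
        then obtain g where "g \<in> J" "g \<in> mpoly_component d" "k d = c g"
          unfolding ideal_quot_grading_def by blast
        with False show ?thesis by blast
      qed
      then obtain g where g: "\<And>d. g d \<in> J" "\<And>d. g d \<in> mpoly_component d" "\<And>d. k d = c (g d)"
        "\<And>d. k d = \<zero>\<^bsub>ideal_quot J I\<^esub> \<Longrightarrow> g d = 0" by metis
      let ?A = "{d. k d \<noteq> \<zero>\<^bsub>ideal_quot J I\<^esub>}"
      have "x = (\<Oplus>\<^bsub>ideal_quot J I\<^esub>d\<in>?A. k d)" using k by blast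
      also have "\<dots> = (\<Oplus>\<^bsub>ideal_quot J I\<^esub>d\<in>?A. c (g d))" using g(3) by simp
      also have "\<dots> = c (\<Sum>d\<in>?A. g d)" by (rule finsum_quot) (use k in blast, rule g(1))
      finally have "(\<Sum>d\<in>?A. g d) - f \<in> I" using f coset_eq by metis
      then have *: "Poly_Mapping.single a (Poly_Mapping.lookup ((\<Sum>d\<in>?A. g d) - f) a) \<in> I" for a
        by (rule It)
      have "g d - t d \<in> I" for d
      proof (cases "d \<in> range deg_of")
        case True
        then obtain a where a: "d = deg_of a" by auto
        have "g d = Poly_Mapping.single a (Poly_Mapping.lookup (\<Sum>d\<in>?A. g d) a)"
          unfolding a
        proof (rule lookup_hom_sum)
          show "finite ?A" using k by blast
          show "g d \<in> mpoly_component d" for d by (rule g(2))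
          show "g d = 0" if "d \<notin> ?A" for d using g(4)[of d] that by blast
        qed
        then show ?thesis using *[of a] by (simp add: a t1 lookup_minus single_diff)
      next
        case False
        then show ?thesis using mpoly_component_not_deg_of[OF False g(2)] t2[OF False] ID(1) by simp
      qed
      then show "k = h" by (auto simp: g(3) h_def coset_eq fun_eq_iff)
    qed
  qed
qed

end

theory Submission
  imports Defs
begin

text \<open>
  All ideals involved are spanned by monomials, so \<open>J/I\<close> has a basis of residue classes of
  monomials, and everything can be read off from the set \<open>E\<close> of their exponent vectors. A homogeneous
  element is a scalar multiple of one such class; hence a Stanley decomposition of \<open>J/I\<close> is the
  same thing as a partition of \<open>E\<close> into finitely many cells \<open>a + \<nat>\<^sup>Z\<close>, and the Stanley depth is
  the largest possible value of the smallest \<open>|Z|\<close> (\<open>cells_of_stanley_decomposition\<close>,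
  \<open>stanley_decomposition_of_cells\<close>, \<open>sdepth_eq\<close>). Regularity of monomial sequences means coprimality:
  the supports of \<open>v\<^sub>1, \<dots>, v\<^sub>p, u\<^bsub>p+1\<^esub>, \<dots>, u\<^sub>q\<close> are nonempty and pairwise disjoint
  (\<open>regular_imp_divided_disjoint\<close>). Put \<open>r = q - p\<close>.

  For the lower bound (\<open>exponents_decomposable\<close>) each condition "\<open>u\<^sub>i\<close> divides", "\<open>v\<^sub>i\<close> does not
  divide" only concerns the variables of one generator and splits into cells of small codimension: 0 for
  "\<open>u\<^sub>j\<close> divides", 1 for "\<open>u\<^sub>i\<close> does not divide", and 1 for "\<open>u\<^sub>i\<close> divides but \<open>v\<^sub>i\<close> does not".
  Conditions on different generators are independent, so codimensions add. The monomials divisible by one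
  of \<open>u\<^sub>1, \<dots>, u\<^sub>p\<close> thus have cells of codimension at most \<open>p\<close>. The remaining ones are divisible by none of
  these and by a nonempty set \<open>T\<close> of the other \<open>r\<close> generators. Here the first condition costs \<open>p\<close>, and
  the nonempty subsets of an \<open>r\<close>-set are partitioned into intervals \<open>[A, B]\<close> with \<open>2|B| \<ge> r\<close>
  (\<open>nonempty_interval_partition\<close>); the condition \<open>A \<subseteq> T \<subseteq> B\<close> costs only \<open>r - |B| \<le> \<lfloor>r/2\<rfloor>\<close>.

  For the upper bound (\<open>partition_bound\<close>), pick one variable in each generator and look only at the
  monomials whose exponents are huge at the unpicked variables, just too small for \<open>u\<^sub>i\<close> at the
  first \<open>p\<close> picked variables, and equal to or one less than the exponent of \<open>u\<^sub>j\<close> at the other \<open>r\<close>.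
  They form a Boolean lattice, of which only the bottom element lies outside \<open>E\<close>. A cell with a set \<open>Z\<close>
  of free variables meets it, if at all, in an interval; the cells of the \<open>r\<close> atoms then define an
  oriented graph on the atoms, for the join of two atoms lies in only one cell. Some vertex has out-degree
  less than \<open>r/2\<close>, and the cell of that atom has \<open>|Z| \<le> n - p - \<lfloor>r/2\<rfloor>\<close>.
\<close>

section \<open>Partitioning nonempty sets into intervals with large tops\<close>

text \<open>
  Read a set as the 0/1 word of its characteristic function along the list \<open>xs\<close>, and cut the word into
  tiles \<open>1\<close>, \<open>10\<close> and \<open>00\<close>. The words with the same division into one- and two-letter tiles form an
  interval \<open>[A, B]\<close> of sets: \<open>A\<close> consists of the one-letter tiles, and \<open>B\<close> has in addition the first
  position of each two-letter tile.
\<close>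

fun tile_intervals :: "'a list \<Rightarrow> ('a set \<times> 'a set) set" where
  "tile_intervals [] = {({}, {})}"
| "tile_intervals [x] = {({x}, {x})}"
| "tile_intervals (x # y # xs) =
     (\<lambda>(A, B). (insert x A, insert x B)) ` tile_intervals (y # xs) \<union>
     (\<lambda>(A, B). (A, insert x B)) ` tile_intervals xs"

definition between :: "'a set \<Rightarrow> 'a set \<times> 'a set \<Rightarrow> bool" where
  "between S I \<longleftrightarrow> fst I \<subseteq> S \<and> S \<subseteq> snd I"

lemma finite_tile_intervals: "finite (tile_intervals xs)"
  by (induction xs rule: tile_intervals.induct) auto

lemma tile_intervals_bounds:
  "(A, B) \<in> tile_intervals xs \<Longrightarrow> A \<subseteq> B \<and> B \<subseteq> set xs"
proof (induction xs arbitrary: A B rule: tile_intervals.induct)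
  case (3 x y xs)
  from "3.prems" consider
      A' B' where "(A', B') \<in> tile_intervals (y # xs)" "A = insert x A'" "B = insert x B'"
    | B' where "(A, B') \<in> tile_intervals xs" "B = insert x B'"
    by auto
  then show ?case
  proof cases
    case 1
    then show ?thesis using "3.IH"(1)[OF 1(1)] by auto
  next
    case 2
    then show ?thesis using "3.IH"(2)[OF 2(1)] by auto
  qed
qed simp_all

text \<open>
  Counting letters: \<open>B\<close> has one element for each tile, and the one-letter tiles are counted by \<open>A\<close>.
\<close>

lemma tile_intervals_card:
  "distinct xs \<Longrightarrow> (A, B) \<in> tile_intervals xs \<Longrightarrow> 2 * card B = length xs + card A"
proof (induction xs arbitrary: A B rule: tile_intervals.induct)
  case (3 x y xs)
  from "3.prems"(2) consider
      (one) A' B' where "(A', B') \<in> tile_intervals (y # xs)" "A = insert x A'" "B = insert x B'"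
    | (two) B' where "(A, B') \<in> tile_intervals xs" "B = insert x B'"
    by auto
  then show ?case
  proof cases
    case one
    have "A' \<subseteq> B'" "B' \<subseteq> set (y # xs)" using tile_intervals_bounds[OF one(1)] by auto
    moreover from this have "finite B'" "finite A'" by (meson List.finite_set finite_subset)+
    ultimately have "finite B'" "finite A'" "x \<notin> B'" "x \<notin> A'" using "3.prems"(1) by auto
    then show ?thesis using "3.IH"(1)[OF _ one(1)] "3.prems"(1) one by simp
  next
    case two
    have "B' \<subseteq> set xs" using tile_intervals_bounds[OF two(1)] by auto
    moreover from this have "finite B'" by (meson List.finite_set finite_subset)
    ultimately have "finite B'" "x \<notin> B'" using "3.prems"(1) by auto
    then show ?thesis using "3.IH"(2)[OF _ two(1)] "3.prems"(1) two by simp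
  qed
qed simp_all

definition zero_run :: "'a set \<Rightarrow> 'a list \<Rightarrow> nat" where
  "zero_run S xs = length (takeWhile (\<lambda>x. x \<notin> S) xs)"

lemma zero_run_Cons: "zero_run S (x # xs) = (if x \<in> S then 0 else Suc (zero_run S xs))"
  by (simp add: zero_run_def)

lemma zero_run_Nil: "zero_run S [] = 0"
  by (simp add: zero_run_def)

lemma zero_run_remove: "x \<notin> set xs \<Longrightarrow> zero_run (S - {x}) xs = zero_run S xs"
  by (induction xs) (auto simp: zero_run_Cons zero_run_Nil)

definition intervals_containing :: "'a list \<Rightarrow> 'a set \<Rightarrow> ('a set \<times> 'a set) set" where
  "intervals_containing xs S = {I \<in> tile_intervals xs. between S I}"

lemma intervals_containing_Cons_Cons:
  assumes "distinct (x # y # xs)" "S \<subseteq> set (x # y # xs)"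
  shows "intervals_containing (x # y # xs) S =
    (if x \<in> S then (\<lambda>(A, B). (insert x A, insert x B)) ` intervals_containing (y # xs) (S - {x}) else {}) \<union>
    (if y \<in> S then {} else (\<lambda>(A, B). (A, insert x B)) ` intervals_containing xs (S - {x}))"
proof -
  let ?f = "\<lambda>(A, B). (insert x A, insert x B)" and ?g = "\<lambda>(A, B). (A, insert x B)"
  have f: "between S (?f I) \<longleftrightarrow> x \<in> S \<and> between (S - {x}) I" if "I \<in> tile_intervals (y # xs)" for I
  proof -
    obtain A B where I: "I = (A, B)" by (cases I)
    then have "A \<subseteq> B" "B \<subseteq> set (y # xs)" using tile_intervals_bounds[of A B "y # xs"] that by simp_all
    then have "x \<notin> A" using assms(1) by auto
    then show ?thesis unfolding I between_def by auto
  qed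
  have g: "between S (?g I) \<longleftrightarrow> y \<notin> S \<and> between (S - {x}) I" if "I \<in> tile_intervals xs" for I
  proof -
    obtain A B where I: "I = (A, B)" by (cases I)
    then have "A \<subseteq> B" "B \<subseteq> set xs" using tile_intervals_bounds[of A B xs] that by simp_all
    then have "x \<notin> A" "y \<notin> insert x B" using assms(1) by auto
    then show ?thesis unfolding I between_def by auto
  qed
  have "intervals_containing (x # y # xs) S =
      ?f ` {I \<in> tile_intervals (y # xs). between S (?f I)} \<union> ?g ` {I \<in> tile_intervals xs. between S (?g I)}"
    unfolding intervals_containing_def tile_intervals.simps by blast
  also have "{I \<in> tile_intervals (y # xs). between S (?f I)} = (if x \<in> S then intervals_containing (y # xs) (S - {x}) else {})"
    unfolding intervals_containing_def using f by auto
  also have "{I \<in> tile_intervals xs. between S (?g I)} = (if y \<in> S then {} else intervals_containing xs (S - {x}))"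
    unfolding intervals_containing_def using g by auto
  finally show ?thesis by auto
qed

text \<open>
  A tile never ends with \<open>1\<close> unless it is \<open>1\<close> itself, so each block \<open>10\<dots>0\<close> between two ones is tiled
  separately, and in exactly one way: by \<open>1\<close> and then pairs \<open>00\<close>, or by \<open>10\<close> and then pairs \<open>00\<close>,
  according to parity. The zeros before the first \<open>1\<close> must be tiled by pairs \<open>00\<close>, which is the only
  obstruction.
\<close>

lemma intervals_containing_zero_run:
  assumes "distinct xs" "S \<subseteq> set xs"
  shows "if even (zero_run S xs) then is_singleton (intervals_containing xs S) else intervals_containing xs S = {}"
  using assms
proof (induction xs arbitrary: S rule: tile_intervals.induct)
  case 1
  then have "intervals_containing [] S = {({}, {})}" by (auto simp: between_def intervals_containing_def)
  then show ?case by (simp add: zero_run_Nil is_singleton_altdef)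
next
  case (2 x)
  then have "intervals_containing [x] S = (if x \<in> S then {({x}, {x})} else {})"
    by (auto simp: between_def intervals_containing_def)
  then show ?case by (simp add: zero_run_Cons zero_run_Nil is_singleton_altdef)
next
  case (3 x y xs)
  have d: "x \<notin> set (y # xs)" "x \<noteq> y" "y \<notin> set xs" "distinct xs" "distinct (y # xs)"
    using "3.prems"(1) by auto
  have z: "zero_run (S - {x}) xs = zero_run S xs" "zero_run (S - {x}) (y # xs) = zero_run S (y # xs)"
    using d by (auto intro: zero_run_remove)
  have sub: "S - {x} \<subseteq> set (y # xs)" "y \<notin> S \<Longrightarrow> S - {x} \<subseteq> set xs" using "3.prems"(2) by auto
  have f: "if even (zero_run S (y # xs)) then is_singleton (intervals_containing (y # xs) (S - {x}))
      else intervals_containing (y # xs) (S - {x}) = {}"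
    using "3.IH"(1)[OF d(5) sub(1)] z by simp
  have g: "y \<notin> S \<Longrightarrow> if even (zero_run S xs) then is_singleton (intervals_containing xs (S - {x}))
      else intervals_containing xs (S - {x}) = {}"
    using "3.IH"(2)[OF d(4) sub(2)] z by simp
  have im: "is_singleton (h ` A)" if "is_singleton A" for A and h :: "'a set \<times> 'a set \<Rightarrow> 'a set \<times> 'a set"
    using that by (auto simp: is_singleton_def)
  show ?case
    unfolding intervals_containing_Cons_Cons[OF "3.prems"] using f g im
    by (cases "x \<in> S"; cases "y \<in> S"; cases "even (zero_run S xs)") (simp_all add: zero_run_Cons)
qed

lemma zero_run_disjoint: "S \<inter> set xs = {} \<Longrightarrow> zero_run S xs = length xs"
  by (induction xs) (auto simp: zero_run_Cons zero_run_Nil)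

lemma zero_run_append: "S \<inter> set xs \<noteq> {} \<Longrightarrow> zero_run S (xs @ ys) = zero_run S xs"
  by (induction xs) (auto simp: zero_run_Cons)

text \<open>
  The list is read cyclically. If the word starts with an even number of zeros, it is tiled as above.
  Otherwise its first letter \<open>0\<close> is the second half of a two-letter tile that begins at the last
  position. The number of one-letter tiles has the parity of \<open>card R\<close>, so it is positive; this gives both
  \<open>A \<noteq> {}\<close> and the bound on \<open>B\<close>.
\<close>

lemma nonempty_interval_partition_odd:
  assumes "odd (card R)"
  shows "\<exists>P. finite P \<and> (\<forall>(A, B)\<in>P. A \<noteq> {} \<and> A \<subseteq> B \<and> B \<subseteq> R \<and> card R \<le> 2 * card B) \<and>
    (\<forall>S. S \<subseteq> R \<longrightarrow> S \<noteq> {} \<longrightarrow> is_singleton {I \<in> P. between S I})"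
proof -
  have "finite R"
  proof (rule ccontr)
    assume "infinite R"
    then show False using assms by simp
  qed
  then obtain xs where xs: "set xs = R" "distinct xs" using finite_distinct_list by blast
  have len: "odd (length xs)" using assms xs distinct_card by metis
  have ne: "A \<noteq> {}" if "(A, B) \<in> tile_intervals ys" "distinct ys" "odd (length ys)" for A B and ys :: "'a list"
  proof
    assume "A = {}"
    then have "2 * card B = length ys" using tile_intervals_card[OF that(2,1)] by simp
    then show False using that(3) by presburger
  qed
  show ?thesis
  proof (cases "length xs = 1")
    case True
    then obtain x where x: "xs = [x]" by (auto simp: length_Suc_conv)
    then have R: "R = {x}" using xs by auto
    have "{I \<in> {({x}, {x})}. between S I} = {({x}, {x})}" if "S \<subseteq> R" "S \<noteq> {}" for S
      using that R by (auto simp: between_def)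
    then show ?thesis using R by (intro exI[of _ "{({x}, {x})}"]) (simp add: is_singleton_altdef)
  next
    case False
    then obtain x ws z where w: "xs = x # ws @ [z]"
    proof (cases xs)
      case (Cons x ys)
      then show ?thesis using that False by (cases ys rule: rev_cases) auto
    qed (use len in auto)
    have d: "distinct ws" "x \<notin> set ws" "z \<notin> set ws" "x \<noteq> z" "odd (length ws)"
      using xs(2) len by (auto simp: w)
    \<comment> \<open>The second part consists of the tilings in which a two-letter tile runs from \<open>z\<close> around to \<open>x\<close>.\<close>
    let ?g = "\<lambda>(A, B). (A, insert z B)"
    let ?P = "tile_intervals xs \<union> ?g ` tile_intervals ws"
    have "A \<noteq> {} \<and> A \<subseteq> B \<and> B \<subseteq> R \<and> card R \<le> 2 * card B" if "(A, B) \<in> ?P" for A B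
    proof -
      from that consider "(A, B) \<in> tile_intervals xs"
        | B' where "(A, B') \<in> tile_intervals ws" "B = insert z B'" by auto
      then show ?thesis
      proof cases
        case 1
        then show ?thesis
          using ne[OF 1 xs(2) len] tile_intervals_bounds[OF 1] tile_intervals_card[OF xs(2) 1]
            distinct_card[OF xs(2)] xs(1) by simp
      next
        case 2
        note b = tile_intervals_bounds[OF 2(1)]
        have "card B = Suc (card B')"
          unfolding 2(2) using b d finite_subset[of B' "set ws"] by (intro card_insert_disjoint) auto
        moreover have "card R = length ws + 2" using xs(1) distinct_card[OF xs(2)] w by auto
        ultimately have "card R \<le> 2 * card B" using tile_intervals_card[OF d(1) 2(1)] by simp
        then show ?thesis using ne[OF 2(1) d(1,5)] b 2(2) xs(1) w by auto
      qed
    qed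
    then have "\<forall>(A, B)\<in>?P. A \<noteq> {} \<and> A \<subseteq> B \<and> B \<subseteq> R \<and> card R \<le> 2 * card B" by blast
    moreover have "is_singleton {I \<in> ?P. between S I}" if S: "S \<subseteq> R" "S \<noteq> {}" for S
    proof -
      have g: "between S (?g I) \<longleftrightarrow> x \<notin> S \<and> between (S - {z}) I" if "I \<in> tile_intervals ws" for I
      proof -
        obtain A B where I: "I = (A, B)" by (cases I)
        then have "A \<subseteq> B" "B \<subseteq> set ws" using tile_intervals_bounds[of A B ws] that by simp_all
        then have "z \<notin> A" "x \<notin> insert z B" using d by auto
        then show ?thesis unfolding I between_def by auto
      qed
      have "{I \<in> ?P. between S I} = intervals_containing xs S \<union> ?g ` {I \<in> tile_intervals ws. between S (?g I)}"
        unfolding intervals_containing_def by blast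
      also have "{I \<in> tile_intervals ws. between S (?g I)} = (if x \<in> S then {} else intervals_containing ws (S - {z}))"
        unfolding intervals_containing_def using g by auto
      finally have eq: "{I \<in> ?P. between S I} =
        intervals_containing xs S \<union> (if x \<in> S then {} else ?g ` intervals_containing ws (S - {z}))" by auto
      have m1: "if even (zero_run S xs) then is_singleton (intervals_containing xs S) else intervals_containing xs S = {}"
        by (rule intervals_containing_zero_run) (use xs S in auto)
      have "x \<notin> S \<Longrightarrow> S - {z} \<subseteq> set ws" using S xs w by auto
      then have m2: "x \<notin> S \<Longrightarrow> if even (zero_run S ws) then is_singleton (intervals_containing ws (S - {z})) else intervals_containing ws (S - {z}) = {}"
        using intervals_containing_zero_run[OF d(1), of "S - {z}"] zero_run_remove[OF d(3), of S] by simp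
      \<comment> \<open>Exactly one of the two kinds of tilings exists for a given nonempty set.\<close>
      have par: "even (zero_run S xs) \<longleftrightarrow> odd (zero_run S ws)" if "x \<notin> S"
      proof (cases "S \<inter> set ws = {}")
        case True
        then have "z \<in> S" using S xs w that by auto
        then have "zero_run S (ws @ [z]) = length ws"
          using True unfolding zero_run_def by (subst takeWhile_append2) auto
        then show ?thesis using that d(5) zero_run_disjoint[OF True] by (simp add: w zero_run_Cons)
      next
        case False
        then show ?thesis using that zero_run_append[OF False, of "[z]"] by (simp add: w zero_run_Cons)
      qed
      have im: "is_singleton (?g ` A)" if "is_singleton A" for A
        using that by (auto simp: is_singleton_def)
      have "is_singleton (intervals_containing xs S \<union> (if x \<in> S then {} else ?g ` intervals_containing ws (S - {z})))"
      proof (cases "x \<in> S")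
        case True
        then have "zero_run S xs = 0" by (simp add: w zero_run_Cons)
        then show ?thesis using m1 True by simp
      next
        case False
        then show ?thesis using m1 m2 par im by (cases "even (zero_run S ws)") simp_all
      qed
      then show ?thesis unfolding eq .
    qed
    ultimately show ?thesis using finite_tile_intervals by (intro exI[of _ ?P]) blast
  qed
qed

text \<open>
  For an even number of elements, one element \<open>z\<close> is split off: all sets that contain \<open>z\<close> make up the
  single interval from \<open>{z}\<close> to the whole set, and the others lie in a set of odd size.
\<close>

lemma nonempty_interval_partition:
  assumes "finite R"
  shows "\<exists>P. finite P \<and> (\<forall>(A, B)\<in>P. A \<noteq> {} \<and> A \<subseteq> B \<and> B \<subseteq> R \<and> card R \<le> 2 * card B) \<and>
    (\<forall>S. S \<subseteq> R \<longrightarrow> S \<noteq> {} \<longrightarrow> is_singleton {I \<in> P. between S I})"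
proof (cases "odd (card R)")
  case True
  then show ?thesis by (rule nonempty_interval_partition_odd)
next
  case even: False
  show ?thesis
  proof (cases "R = {}")
    case True
    then show ?thesis by (intro exI[of _ "{}"]) auto
  next
    case False
    then obtain z where z: "z \<in> R" by blast
    have cR: "card R = Suc (card (R - {z}))" using assms z by (metis card.remove)
    then have "odd (card (R - {z}))" using even by simp
    from nonempty_interval_partition_odd[OF this] obtain P where P: "finite P"
      "\<forall>(A, B)\<in>P. A \<noteq> {} \<and> A \<subseteq> B \<and> B \<subseteq> R - {z} \<and> card (R - {z}) \<le> 2 * card B"
      "\<forall>S. S \<subseteq> R - {z} \<longrightarrow> S \<noteq> {} \<longrightarrow> is_singleton {I \<in> P. between S I}" by blast
    have "card R \<le> 2 * card B" if "(A, B) \<in> P" for A B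
    proof -
      have "card (R - {z}) \<le> 2 * card B" using P(2) that by auto
      then show ?thesis using cR even by presburger
    qed
    then have 1: "\<forall>(A, B)\<in>insert ({z}, R) P. A \<noteq> {} \<and> A \<subseteq> B \<and> B \<subseteq> R \<and> card R \<le> 2 * card B"
      using P(2) z by auto
    have "is_singleton {I \<in> insert ({z}, R) P. between S I}" if S: "S \<subseteq> R" "S \<noteq> {}" for S
    proof (cases "z \<in> S")
      case True
      have "\<not> between S I" if "I \<in> P" for I
        using P(2) that True unfolding between_def by (cases I) fastforce
      then have "{I \<in> insert ({z}, R) P. between S I} = {({z}, R)}"
        using True S by (auto simp: between_def)
      then show ?thesis by (simp add: is_singleton_altdef)
    next
      case False
      then have "{I \<in> insert ({z}, R) P. between S I} = {I \<in> P. between S I}"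
        by (auto simp: between_def)
      moreover have "S \<subseteq> R - {z}" using S False by auto
      ultimately show ?thesis using P(3) S(2) by metis
    qed
    then show ?thesis using 1 P(1) by (intro exI[of _ "insert ({z}, R) P"]) blast
  qed
qed

section \<open>Partitions of sets of exponent vectors into cells\<close>

text \<open>
  The exponent vectors of the monomials in \<open>x\<^sup>a K[Z]\<close>, for the pair \<open>(a, Z)\<close>.
\<close>

definition cell :: "('n \<Rightarrow> nat) \<times> 'n set \<Rightarrow> ('n \<Rightarrow> nat) set" where
  "cell c = {b. fst c \<le> b \<and> (\<forall>x. x \<notin> snd c \<longrightarrow> b x = fst c x)}"

definition partitions :: "(('n \<Rightarrow> nat) \<times> 'n set) set \<Rightarrow> ('n \<Rightarrow> nat) set \<Rightarrow> bool" where
  "partitions P E \<longleftrightarrow> (\<forall>b. if b \<in> E then is_singleton {c \<in> P. b \<in> cell c} else {c \<in> P. b \<in> cell c} = {})"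

lemma partitions_singleton: "partitions P E \<Longrightarrow> b \<in> E \<Longrightarrow> is_singleton {c \<in> P. b \<in> cell c}"
  unfolding partitions_def by (drule spec[of _ b]) simp

lemma partitions_cell_subset:
  assumes "partitions P E" "c \<in> P"
  shows "cell c \<subseteq> E"
proof (rule subsetI, rule ccontr)
  fix b assume b: "b \<in> cell c" "b \<notin> E"
  then have "{c \<in> P. b \<in> cell c} = {}" using assms(1) unfolding partitions_def by metis
  then show False using b(1) assms(2) by blast
qed

definition supp :: "('n \<Rightarrow> nat) \<Rightarrow> 'n set" where
  "supp a = {x. a x \<noteq> 0}"

lemma is_singleton_Collect_unique:
  assumes "is_singleton {x \<in> A. Q x}" "x \<in> A" "Q x" "y \<in> A" "Q y"
  shows "x = y"
proof -
  obtain z where "{x \<in> A. Q x} = {z}" using assms(1) by (auto simp: is_singleton_def)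
  then have "x \<in> {z}" "y \<in> {z}" using assms(2-) by blast+
  then show ?thesis by simp
qed

text \<open>
  The parameter \<open>k\<close> bounds the codimension of the cells. The set \<open>W\<close> of coordinates is there to make
  products possible: cells that restrict only coordinates in \<open>W\<close> can be intersected with cells that
  restrict only coordinates outside \<open>W\<close>.
\<close>

definition cell_decomposable :: "'n set \<Rightarrow> ('n \<Rightarrow> nat) set \<Rightarrow> nat \<Rightarrow> bool" where
  "cell_decomposable W E k \<longleftrightarrow> (\<exists>P. finite P \<and> partitions P E \<and>
     (\<forall>(a, Z)\<in>P. supp a \<subseteq> W \<and> - Z \<subseteq> W \<and> card (- Z) \<le> k))"

lemma cell_decomposable_mono:
  "cell_decomposable W E k \<Longrightarrow> W \<subseteq> W' \<Longrightarrow> k \<le> k' \<Longrightarrow> cell_decomposable W' E k'"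
  unfolding cell_decomposable_def by (elim exE, rule_tac x = P in exI) fastforce

lemma cell_decomposable_empty: "cell_decomposable W {} k"
  unfolding cell_decomposable_def by (intro exI[of _ "{}"]) (simp add: partitions_def)

lemma cell_decomposable_cell:
  "supp a \<subseteq> W \<Longrightarrow> - Z \<subseteq> W \<Longrightarrow> card (- Z) \<le> k \<Longrightarrow> cell_decomposable W (cell (a, Z)) k"
  unfolding cell_decomposable_def
  by (intro exI[of _ "{(a, Z)}"])
     (auto simp: partitions_def is_singleton_def)

lemma cell_decomposable_UNIV: "cell_decomposable W (UNIV :: ('n \<Rightarrow> nat) set) k"
proof -
  have "cell ((\<lambda>_. 0), UNIV) = (UNIV :: ('n \<Rightarrow> nat) set)" by (auto simp: cell_def le_fun_def)
  then show ?thesis using cell_decomposable_cell[of "\<lambda>_. 0" W UNIV k] by (simp add: supp_def)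
qed

lemma cell_decomposable_Un:
  assumes "cell_decomposable W E k" "cell_decomposable W Y k" "E \<inter> Y = {}"
  shows "cell_decomposable W (E \<union> Y) k"
proof -
  from assms(1) obtain P where P: "finite P" "partitions P E"
    "\<forall>(a, Z)\<in>P. supp a \<subseteq> W \<and> - Z \<subseteq> W \<and> card (- Z) \<le> k" by (auto simp: cell_decomposable_def)
  from assms(2) obtain Q where Q: "finite Q" "partitions Q Y"
    "\<forall>(a, Z)\<in>Q. supp a \<subseteq> W \<and> - Z \<subseteq> W \<and> card (- Z) \<le> k" by (auto simp: cell_decomposable_def)
  have "partitions (P \<union> Q) (E \<union> Y)"
    unfolding partitions_def
  proof
    fix b
    have "{c \<in> P \<union> Q. b \<in> cell c} = {c \<in> P. b \<in> cell c} \<union> {c \<in> Q. b \<in> cell c}" by blast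
    moreover have "if b \<in> E then is_singleton {c \<in> P. b \<in> cell c} else {c \<in> P. b \<in> cell c} = {}"
      "if b \<in> Y then is_singleton {c \<in> Q. b \<in> cell c} else {c \<in> Q. b \<in> cell c} = {}"
      using P(2) Q(2) unfolding partitions_def by blast+
    ultimately show "if b \<in> E \<union> Y then is_singleton {c \<in> P \<union> Q. b \<in> cell c} else {c \<in> P \<union> Q. b \<in> cell c} = {}"
      using assms(3) by (cases "b \<in> E"; cases "b \<in> Y") auto
  qed
  then show ?thesis unfolding cell_decomposable_def using P Q by (intro exI[of _ "P \<union> Q"]) auto
qed

lemma cell_decomposable_UN:
  assumes "finite A" "\<And>i. i \<in> A \<Longrightarrow> cell_decomposable W (E i) k"
    "\<And>i j. i \<in> A \<Longrightarrow> j \<in> A \<Longrightarrow> i \<noteq> j \<Longrightarrow> E i \<inter> E j = {}"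
  shows "cell_decomposable W (\<Union>i\<in>A. E i) k"
  using assms
proof (induction A rule: finite_induct)
  case empty
  then show ?case by (simp add: cell_decomposable_empty)
next
  case (insert i A)
  then have "E i \<inter> (\<Union>i\<in>A. E i) = {}" by blast
  then show ?case using insert by (auto intro!: cell_decomposable_Un)
qed

lemma cell_Int:
  assumes "supp a \<subseteq> W" "- Z \<subseteq> W" "supp a' \<subseteq> W'" "- Z' \<subseteq> W'" "W \<inter> W' = {}"
  shows "cell (a, Z) \<inter> cell (a', Z') = cell (\<lambda>x. a x + a' x, Z \<inter> Z')"
proof -
  have 1: "a' x = 0" "x \<in> Z'" if "x \<in> W" for x using that assms by (auto simp: supp_def)
  have 2: "a x = 0" "x \<in> Z" if "x \<notin> W" for x using that assms by (auto simp: supp_def)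
  show ?thesis
  proof (rule Set.set_eqI)
    fix b
    have "(a x \<le> b x \<and> (x \<notin> Z \<longrightarrow> b x = a x)) \<and> (a' x \<le> b x \<and> (x \<notin> Z' \<longrightarrow> b x = a' x)) \<longleftrightarrow>
       a x + a' x \<le> b x \<and> (x \<notin> Z \<inter> Z' \<longrightarrow> b x = a x + a' x)" for x
      using 1[of x] 2[of x] by (cases "x \<in> W") auto
    then show "b \<in> cell (a, Z) \<inter> cell (a', Z') \<longleftrightarrow> b \<in> cell (\<lambda>x. a x + a' x, Z \<inter> Z')"
      unfolding cell_def le_fun_def by simp blast
  qed
qed

text \<open>
  On disjoint sets of coordinates the intersections of the cells of both partitions are again cells, and
  codimensions add up.
\<close>

lemma cell_decomposable_Int:
  assumes "cell_decomposable W E k" "cell_decomposable W' Y l" "W \<inter> W' = {}"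
  shows "cell_decomposable (W \<union> W') (E \<inter> Y) (k + l)"
proof -
  from assms(1) obtain P where P: "finite P" "partitions P E"
    "\<forall>(a, Z)\<in>P. supp a \<subseteq> W \<and> - Z \<subseteq> W \<and> card (- Z) \<le> k" by (auto simp: cell_decomposable_def)
  from assms(2) obtain Q where Q: "finite Q" "partitions Q Y"
    "\<forall>(a, Z)\<in>Q. supp a \<subseteq> W' \<and> - Z \<subseteq> W' \<and> card (- Z) \<le> l" by (auto simp: cell_decomposable_def)
  let ?m = "\<lambda>(c, c'). (\<lambda>x. fst c x + fst c' x, snd c \<inter> snd c')"
  have m: "cell (?m (c, c')) = cell c \<inter> cell c'" if "c \<in> P" "c' \<in> Q" for c c'
    using cell_Int[of "fst c" W "snd c" "fst c'" W' "snd c'"] that P(3) Q(3) assms(3)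
    by (auto simp: case_prod_beta)
  have "partitions (?m ` (P \<times> Q)) (E \<inter> Y)"
    unfolding partitions_def
  proof
    fix b
    have "{c \<in> ?m ` (P \<times> Q). b \<in> cell c} = ?m ` {cc \<in> P \<times> Q. b \<in> cell (?m cc)}" by blast
    also have "{cc \<in> P \<times> Q. b \<in> cell (?m cc)} = {c \<in> P. b \<in> cell c} \<times> {c \<in> Q. b \<in> cell c}"
      using m by auto
    finally have eq: "{c \<in> ?m ` (P \<times> Q). b \<in> cell c} = ?m ` ({c \<in> P. b \<in> cell c} \<times> {c \<in> Q. b \<in> cell c})" .
    have "if b \<in> E then is_singleton {c \<in> P. b \<in> cell c} else {c \<in> P. b \<in> cell c} = {}"
      "if b \<in> Y then is_singleton {c \<in> Q. b \<in> cell c} else {c \<in> Q. b \<in> cell c} = {}"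
      using P(2) Q(2) unfolding partitions_def by blast+
    then show "if b \<in> E \<inter> Y then is_singleton {c \<in> ?m ` (P \<times> Q). b \<in> cell c} else {c \<in> ?m ` (P \<times> Q). b \<in> cell c} = {}"
      unfolding eq by (cases "b \<in> E"; cases "b \<in> Y") (auto simp: is_singleton_def)
  qed
  moreover have "supp (fst (?m cc)) \<subseteq> W \<union> W' \<and> - snd (?m cc) \<subseteq> W \<union> W' \<and> card (- snd (?m cc)) \<le> k + l"
    if cc: "cc \<in> P \<times> Q" for cc
  proof -
    obtain a Z a' Z' where c: "cc = ((a, Z), (a', Z'))" "(a, Z) \<in> P" "(a', Z') \<in> Q" using cc by auto
    have "card (- (Z \<inter> Z')) \<le> card (- Z) + card (- Z')" by (simp add: card_Un_le)
    then show ?thesis using P(3) Q(3) c by (fastforce simp: supp_def)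
  qed
  ultimately show ?thesis unfolding cell_decomposable_def using P(1) Q(1)
    by (intro exI[of _ "?m ` (P \<times> Q)"]) fastforce
qed

lemma cell_decomposable_INT:
  assumes "finite A" "\<And>i. i \<in> A \<Longrightarrow> cell_decomposable (W i) (E i) (k i)"
    "\<And>i j. i \<in> A \<Longrightarrow> j \<in> A \<Longrightarrow> i \<noteq> j \<Longrightarrow> W i \<inter> W j = {}"
  shows "cell_decomposable (\<Union>i\<in>A. W i) (\<Inter>i\<in>A. E i) (\<Sum>i\<in>A. k i)"
  using assms
proof (induction A rule: finite_induct)
  case empty
  then show ?case by (simp add: cell_decomposable_UNIV)
next
  case (insert i A)
  then have "W i \<inter> (\<Union>i\<in>A. W i) = {}" by blast
  then have "cell_decomposable (W i \<union> (\<Union>i\<in>A. W i)) (E i \<inter> (\<Inter>i\<in>A. E i)) (k i + (\<Sum>i\<in>A. k i))"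
    using insert by (auto intro!: cell_decomposable_Int)
  then show ?case using insert by simp
qed

lemma cell_decomposable_ge:
  "supp a \<subseteq> W \<Longrightarrow> cell_decomposable W {b. a \<le> b} 0"
  using cell_decomposable_cell[of a W UNIV 0] by (simp add: cell_def)

text \<open>
  Sort the vectors by the first coordinate in which they fall below \<open>e\<close> and by their value there: the
  coordinates before it are bounded below by \<open>e\<close>, those after it by \<open>a\<close>, and only one coordinate is
  fixed. The induction peels off that first coordinate.
\<close>

lemma cell_decomposable_ge_not_ge:
  assumes "finite F" "\<And>x. x \<in> F \<Longrightarrow> a x \<le> e x"
  shows "cell_decomposable F {b. (\<forall>x\<in>F. a x \<le> b x) \<and> (\<exists>x\<in>F. b x < e x)} 1"
  using assms
proof (induction F rule: finite_induct)
  case empty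
  then show ?case by (simp add: cell_decomposable_empty)
next
  case (insert y F)
  let ?G = "{b. \<forall>x\<in>F. a x \<le> b x}" and ?L = "{b. (\<forall>x\<in>F. a x \<le> b x) \<and> (\<exists>x\<in>F. b x < e x)}"
  have pt: "cell_decomposable {y} {b. b y = t} 1" for t
  proof -
    have "{b. b y = t} = cell (\<lambda>x. if x = y then t else 0, - {y})" by (auto simp: cell_def le_fun_def)
    moreover have "supp (\<lambda>x. if x = y then t else 0) \<subseteq> {y}" by (auto simp: supp_def)
    ultimately show ?thesis
      using cell_decomposable_cell[of "\<lambda>x. if x = y then t else 0" "{y}" "- {y}" 1] by simp
  qed
  have ray: "cell_decomposable {y} {b. t \<le> b y} 0" for t
  proof -
    have "{b. t \<le> b y} = {b. (\<lambda>x. if x = y then t else 0) \<le> b}" by (auto simp: le_fun_def)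
    moreover have "supp (\<lambda>x. if x = y then t else 0) \<subseteq> {y}" by (auto simp: supp_def)
    ultimately show ?thesis using cell_decomposable_ge[of "\<lambda>x. if x = y then t else 0" "{y}"] by simp
  qed
  have "{b. a y \<le> b y \<and> b y < e y} = (\<Union>t\<in>{a y..<e y}. {b. b y = t})" by auto
  then have "cell_decomposable {y} {b. a y \<le> b y \<and> b y < e y} 1"
    using cell_decomposable_UN[of "{a y..<e y}" "{y}" "\<lambda>t. {b. b y = t}" 1] pt by auto
  moreover have "cell_decomposable F ?G 0"
  proof -
    have "?G = {b. (\<lambda>x. if x \<in> F then a x else 0) \<le> b}" by (auto simp: le_fun_def)
    moreover have "supp (\<lambda>x. if x \<in> F then a x else 0) \<subseteq> F" by (auto simp: supp_def)
    ultimately show ?thesis using cell_decomposable_ge[of "\<lambda>x. if x \<in> F then a x else 0" F] by simp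
  qed
  ultimately have 1: "cell_decomposable ({y} \<union> F) ({b. a y \<le> b y \<and> b y < e y} \<inter> ?G) 1"
    using cell_decomposable_Int[of "{y}" _ 1 F _ 0] insert.hyps by simp
  have 2: "cell_decomposable ({y} \<union> F) ({b. e y \<le> b y} \<inter> ?L) 1"
    using cell_decomposable_Int[of "{y}" _ 0 F _ 1] insert ray by simp
  have "{b. (\<forall>x\<in>insert y F. a x \<le> b x) \<and> (\<exists>x\<in>insert y F. b x < e x)} =
      ({b. a y \<le> b y \<and> b y < e y} \<inter> ?G) \<union> ({b. e y \<le> b y} \<inter> ?L)"
    using insert.prems[of y] by (auto intro: order_trans[of "a y" "e y"])
  moreover have "({b. a y \<le> b y \<and> b y < e y} \<inter> ?G) \<inter> ({b. e y \<le> b y} \<inter> ?L) = {}" by auto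
  ultimately show ?case using cell_decomposable_Un[OF 1 2] by simp
qed

lemma cell_decomposable_ge_not_ge_fun:
  fixes e :: "'n::finite \<Rightarrow> nat"
  assumes "a \<le> e"
  shows "cell_decomposable (supp e) {b. a \<le> b \<and> \<not> e \<le> b} 1"
proof -
  have "{b. a \<le> b \<and> \<not> e \<le> b} = {b. (\<forall>x\<in>supp e. a x \<le> b x) \<and> (\<exists>x\<in>supp e. b x < e x)}"
  proof (intro Collect_cong)
    fix b
    have "(\<forall>x. a x \<le> b x) \<longleftrightarrow> (\<forall>x\<in>supp e. a x \<le> b x)"
    proof -
      have "a x = 0" if "x \<notin> supp e" for x
        using assms that by (metis (mono_tags, lifting) le_funD le_zero_eq mem_Collect_eq supp_def)
      then show ?thesis by (metis le0)
    qed
    moreover have "(\<forall>x. e x \<le> b x) \<longleftrightarrow> (\<forall>x\<in>supp e. e x \<le> b x)"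
      unfolding supp_def by (metis (mono_tags, lifting) le0 mem_Collect_eq)
    ultimately show "a \<le> b \<and> \<not> e \<le> b \<longleftrightarrow> (\<forall>x\<in>supp e. a x \<le> b x) \<and> (\<exists>x\<in>supp e. b x < e x)"
      unfolding le_fun_def by (simp add: not_le)
  qed
  then show ?thesis using cell_decomposable_ge_not_ge[of "supp e" a e] assms by (simp add: le_fun_def)
qed

lemma cell_decomposable_not_ge:
  fixes e :: "'n::finite \<Rightarrow> nat"
  shows "cell_decomposable (supp e) {b. \<not> e \<le> b} 1"
  using cell_decomposable_ge_not_ge_fun[of "\<lambda>_. 0" e] by (simp add: le_fun_def)

section \<open>The two bounds for the codimension of cells\<close>

text \<open>
  An oriented graph has at most \<open>|R| (|R| - 1) / 2\<close> arcs, so the average out-degree is less than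
  \<open>|R| / 2\<close>.
\<close>

lemma oriented_graph_small_outdegree:
  assumes "finite R" "R \<noteq> {}" "\<And>j. j \<in> R \<Longrightarrow> Out j \<subseteq> R - {j}"
    "\<And>i j. i \<in> R \<Longrightarrow> j \<in> R \<Longrightarrow> i \<in> Out j \<Longrightarrow> j \<notin> Out i"
  shows "\<exists>j\<in>R. 2 * card (Out j) < card R"
proof (rule ccontr)
  assume "\<not> ?thesis"
  then have "(\<Sum>j\<in>R. card R) \<le> (\<Sum>j\<in>R. 2 * card (Out j))" by (intro sum_mono) (auto simp: not_less)
  also have "\<dots> = 2 * card (Sigma R Out)"
    using assms(1,3) by (subst card_SigmaI) (auto simp: sum_distrib_left intro: finite_subset[of _ R])
  also have "\<dots> = card (Sigma R Out) + card ((Sigma R Out)\<inverse>)" by (simp add: card_inverse)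
  also have "\<dots> = card (Sigma R Out \<union> (Sigma R Out)\<inverse>)"
  proof (rule card_Un_disjoint[symmetric])
    have "Sigma R Out \<subseteq> R \<times> R" using assms(3) by auto
    then show "finite (Sigma R Out)" using assms(1) by (meson finite_SigmaI finite_subset)
    then show "finite ((Sigma R Out)\<inverse>)" by simp
    show "Sigma R Out \<inter> (Sigma R Out)\<inverse> = {}" using assms(3,4) by blast
  qed
  also have "\<dots> \<le> card (R \<times> R - (\<lambda>j. (j, j)) ` R)"
    using assms(1,3) by (intro card_mono) auto
  also have "\<dots> = card R * card R - card R"
    using assms(1) by (subst card_Diff_subset) (auto simp: card_image inj_on_def)
  finally have "card R * card R \<le> card R * card R - card R" by simp
  moreover have "0 < card R" using assms(1,2) by (simp add: card_gt_0_iff)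
  ultimately show False by (cases "card R") auto
qed

text \<open>
  Here \<open>a i\<close> is the exponent of \<open>u\<^sub>i\<close>, while \<open>e i\<close> is that of \<open>v\<^sub>i\<close> for \<open>i < p\<close> and that of \<open>u\<^sub>i\<close> for
  \<open>i \<ge> p\<close>. Indices start at 0.
\<close>

locale divided_disjoint_monomials =
  fixes a e :: "nat \<Rightarrow> 'n::finite \<Rightarrow> nat" and p q :: nat
  assumes pq: "p \<le> q"
    and a_nonzero: "i < q \<Longrightarrow> supp (a i) \<noteq> {}"
    and a_le_e: "i < q \<Longrightarrow> a i \<le> e i"
    and a_eq_e: "p \<le> i \<Longrightarrow> i < q \<Longrightarrow> a i = e i"
    and disjoint: "i < q \<Longrightarrow> j < q \<Longrightarrow> i \<noteq> j \<Longrightarrow> supp (e i) \<inter> supp (e j) = {}"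
begin

definition exponents :: "('n \<Rightarrow> nat) set" where
  "exponents = {b. (\<exists>i<q. a i \<le> b) \<and> (\<forall>i<p. \<not> e i \<le> b)}"

lemma supp_a: "i < q \<Longrightarrow> supp (a i) \<subseteq> supp (e i)"
  using a_le_e[of i] by (auto simp: supp_def le_fun_def) (metis order_less_le_trans)

lemma supp_disjoint_UN:
  assumes "A \<subseteq> {..<q}" "B \<subseteq> {..<q}" "A \<inter> B = {}"
  shows "(\<Union>i\<in>A. supp (e i)) \<inter> (\<Union>i\<in>B. supp (e i)) = {}"
proof -
  have "supp (e i) \<inter> supp (e j) = {}" if "i \<in> A" "j \<in> B" for i j
    using disjoint[of i j] that assms by blast
  then show ?thesis by blast
qed

lemma decomposable_no_divisor:
  assumes "m \<le> q"
  shows "cell_decomposable (\<Union>i<m. supp (e i)) {b. \<forall>i<m. \<not> a i \<le> b} m"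
proof -
  have "cell_decomposable (\<Union>i<m. supp (e i)) (\<Inter>i<m. {b. \<not> a i \<le> b}) (\<Sum>i<m. 1)"
  proof (rule cell_decomposable_INT)
    show "cell_decomposable (supp (e i)) {b. \<not> a i \<le> b} 1" if "i \<in> {..<m}" for i
      using cell_decomposable_mono[OF cell_decomposable_not_ge] supp_a[of i] that assms by auto
  qed (use disjoint assms in auto)
  moreover have "(\<Inter>i<m. {b. \<not> a i \<le> b}) = {b. \<forall>i<m. \<not> a i \<le> b}" by auto
  ultimately show ?thesis by simp
qed

text \<open>
  The step from \<open>m\<close> to \<open>m + 1\<close> has two disjoint cases. If some earlier \<open>a i\<close> is below \<open>b\<close>, the
  new condition is \<open>\<not> e m \<le> b\<close>; if \<open>a m\<close> is the first one below \<open>b\<close>, it is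
  \<open>a m \<le> b \<and> \<not> e m \<le> b\<close>. Both have codimension 1.
\<close>

lemma decomposable_some_divisor:
  assumes "m \<le> q"
  shows "cell_decomposable (\<Union>i<m. supp (e i)) {b. (\<exists>i<m. a i \<le> b) \<and> (\<forall>i<m. \<not> e i \<le> b)} m"
  using assms
proof (induction m)
  case 0
  then show ?case by (simp add: cell_decomposable_empty)
next
  case (Suc m)
  let ?S = "{b. (\<exists>i<m. a i \<le> b) \<and> (\<forall>i<m. \<not> e i \<le> b)}" and ?N = "{b. \<forall>i<m. \<not> a i \<le> b}"
  have W: "(\<Union>i<m. supp (e i)) \<inter> supp (e m) = {}"
    using supp_disjoint_UN[of "{..<m}" "{m}"] Suc.prems by auto
  have U: "(\<Union>i<m. supp (e i)) \<union> supp (e m) = (\<Union>i<Suc m. supp (e i))" by (auto simp: less_Suc_eq)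
  have 1: "cell_decomposable (\<Union>i<Suc m. supp (e i)) (?S \<inter> {b. \<not> e m \<le> b}) (Suc m)"
    using cell_decomposable_Int[OF Suc.IH cell_decomposable_not_ge W] Suc.prems U by simp
  have "a m \<le> e m" using a_le_e[of m] Suc.prems by simp
  then have 2: "cell_decomposable (\<Union>i<Suc m. supp (e i)) (?N \<inter> {b. a m \<le> b \<and> \<not> e m \<le> b}) (Suc m)"
    using cell_decomposable_Int[OF decomposable_no_divisor cell_decomposable_ge_not_ge_fun W] Suc.prems U by simp
  have ae: "a i \<le> b" if "e i \<le> b" "i < m" for i b
    using a_le_e[of i] that Suc.prems by (meson Suc_leD order_trans order_less_le_trans)
  have "{b. (\<exists>i<Suc m. a i \<le> b) \<and> (\<forall>i<Suc m. \<not> e i \<le> b)} =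
      (?S \<inter> {b. \<not> e m \<le> b}) \<union> (?N \<inter> {b. a m \<le> b \<and> \<not> e m \<le> b})"
    (is "?D = _")
  proof (intro equalityI subsetI)
    fix b assume b: "b \<in> ?D"
    show "b \<in> (?S \<inter> {b. \<not> e m \<le> b}) \<union> (?N \<inter> {b. a m \<le> b \<and> \<not> e m \<le> b})"
    proof (cases "\<exists>i<m. a i \<le> b")
      case False
      then have "a m \<le> b" using b less_SucE by blast
      then show ?thesis using b False by simp
    qed (use b in simp)
  next
    fix b assume b: "b \<in> (?S \<inter> {b. \<not> e m \<le> b}) \<union> (?N \<inter> {b. a m \<le> b \<and> \<not> e m \<le> b})"
    then have "\<not> e m \<le> b" "(\<exists>i<m. a i \<le> b) \<or> a m \<le> b" by auto
    moreover have "\<forall>i<m. \<not> e i \<le> b" using b ae by auto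
    ultimately show "b \<in> ?D" by (auto simp: less_Suc_eq)
  qed
  moreover have "(?S \<inter> {b. \<not> e m \<le> b}) \<inter> (?N \<inter> {b. a m \<le> b \<and> \<not> e m \<le> b}) = {}" by blast
  ultimately show ?case using cell_decomposable_Un[OF 1 2] by simp
qed

definition divisors :: "('n \<Rightarrow> nat) \<Rightarrow> nat set" where
  "divisors b = {j \<in> {p..<q}. a j \<le> b}"

text \<open>
  Only the indices outside \<open>B\<close>, where \<open>a j \<le> b\<close> is forbidden, cost a dimension.
\<close>

lemma decomposable_divisors_between:
  assumes "B \<subseteq> {p..<q}" "A \<subseteq> B"
  shows "cell_decomposable (\<Union>i\<in>{p..<q}. supp (e i)) {b. between (divisors b) (A, B)} (q - p - card B)"
proof -
  let ?R = "{p..<q}"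
  let ?E = "\<lambda>j. if j \<in> A then {b. a j \<le> b} else if j \<in> B then UNIV else {b. \<not> a j \<le> b}"
  let ?k = "\<lambda>j. if j \<in> B then 0 else (1::nat)"
  have "cell_decomposable (\<Union>i\<in>?R. supp (e i)) (\<Inter>j\<in>?R. ?E j) (\<Sum>j\<in>?R. ?k j)"
  proof (rule cell_decomposable_INT)
    fix j assume "j \<in> ?R"
    then have "a j = e j" using a_eq_e by simp
    then show "cell_decomposable (supp (e j)) (?E j) (?k j)"
      using assms(2) cell_decomposable_ge[of "e j" "supp (e j)"] cell_decomposable_not_ge[of "e j"]
        cell_decomposable_UNIV by auto
  qed (use disjoint in auto)
  moreover have "(\<Inter>j\<in>?R. ?E j) = {b. between (divisors b) (A, B)}"
  proof (intro equalityI subsetI)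
    fix b assume b: "b \<in> (\<Inter>j\<in>?R. ?E j)"
    then have all: "b \<in> ?E j" if "j \<in> ?R" for j using that by (rule INT_D)
    have "a j \<le> b" if "j \<in> A" for j
    proof -
      have "j \<in> ?R" using that assms by blast
      from all[OF this] that show ?thesis by simp
    qed
    moreover have "j \<in> B" if "j \<in> ?R" "a j \<le> b" for j
    proof (rule ccontr)
      assume "j \<notin> B"
      then have "j \<notin> A" using assms(2) by blast
      then show False using all[OF that(1)] that(2) \<open>j \<notin> B\<close> by simp
    qed
    ultimately show "b \<in> {b. between (divisors b) (A, B)}"
      using assms by (auto simp: between_def divisors_def)
  next
    fix b assume "b \<in> {b. between (divisors b) (A, B)}"
    then have "A \<subseteq> divisors b" "divisors b \<subseteq> B" by (auto simp: between_def)
    then show "b \<in> (\<Inter>j\<in>?R. ?E j)" by (auto simp: divisors_def)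
  qed
  moreover have "(\<Sum>j\<in>?R. ?k j) = card (?R - B)"
    by (simp add: sum.If_cases Diff_eq)
  moreover have "card (?R - B) = q - p - card B"
    using assms(1) by (simp add: card_Diff_subset finite_subset)
  ultimately show ?thesis by simp
qed

theorem exponents_decomposable: "cell_decomposable UNIV exponents (p + (q - p) div 2)"
proof -
  let ?W = "\<Union>i<p. supp (e i)" and ?V = "\<Union>i\<in>{p..<q}. supp (e i)"
  let ?S = "{b. (\<exists>i<p. a i \<le> b) \<and> (\<forall>i<p. \<not> e i \<le> b)}" and ?N = "{b. \<forall>i<p. \<not> a i \<le> b}"
  obtain P where P0: "finite P"
      "\<forall>(A, B)\<in>P. A \<noteq> {} \<and> A \<subseteq> B \<and> B \<subseteq> {p..<q} \<and> card {p..<q} \<le> 2 * card B"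
      "\<forall>S. S \<subseteq> {p..<q} \<longrightarrow> S \<noteq> {} \<longrightarrow> is_singleton {I \<in> P. between S I}"
    using nonempty_interval_partition[OF finite_atLeastLessThan, of p q] by (elim exE conjE) (rule that)
  note P = P0(1) P0(2)[THEN bspec, simplified split_beta] P0(3)[rule_format]
  have D: "divisors b \<subseteq> {p..<q}" for b by (auto simp: divisors_def)
  have "cell_decomposable ?V (\<Union>I\<in>P. {b. between (divisors b) I}) ((q - p) div 2)"
  proof (rule cell_decomposable_UN)
    fix I assume I: "I \<in> P"
    obtain A B where AB: "I = (A, B)" by (cases I)
    have "card {p..<q} \<le> 2 * card B" using P(2)[OF I] AB by simp
    then have "q - p - card B \<le> (q - p) div 2" by simp
    then show "cell_decomposable ?V {b. between (divisors b) I} ((q - p) div 2)"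
      using cell_decomposable_mono[OF decomposable_divisors_between[of B A]] P(2)[OF I] AB by simp
  next
    fix I K assume IK: "I \<in> P" "K \<in> P" "I \<noteq> K"
    have False if b: "between (divisors b) I" "between (divisors b) K" for b
    proof -
      have "fst I \<noteq> {}" using P(2)[OF IK(1)] by simp
      then have "divisors b \<noteq> {}" using b(1) by (auto simp: between_def)
      then have "is_singleton {I \<in> P. between (divisors b) I}" using P(3)[OF D] by blast
      then show False using is_singleton_Collect_unique b IK by metis
    qed
    then show "{b. between (divisors b) I} \<inter> {b. between (divisors b) K} = {}" by blast
  qed (rule P(1))
  moreover have "(\<Union>I\<in>P. {b. between (divisors b) I}) = {b. divisors b \<noteq> {}}"
  proof (intro equalityI subsetI)
    fix b assume "b \<in> (\<Union>I\<in>P. {b. between (divisors b) I})"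
    then obtain I where "I \<in> P" "between (divisors b) I" by auto
    then show "b \<in> {b. divisors b \<noteq> {}}" using P(2)[of I] by (auto simp: between_def)
  next
    fix b assume "b \<in> {b. divisors b \<noteq> {}}"
    then have "is_singleton {I \<in> P. between (divisors b) I}" using P(3)[OF D] by blast
    then show "b \<in> (\<Union>I\<in>P. {b. between (divisors b) I})" unfolding is_singleton_def by blast
  qed
  moreover have "?W \<inter> ?V = {}" using pq by (intro supp_disjoint_UN) auto
  ultimately have "cell_decomposable (?W \<union> ?V) (?N \<inter> {b. divisors b \<noteq> {}}) (p + (q - p) div 2)"
    using cell_decomposable_Int[OF decomposable_no_divisor[OF pq]] by simp
  then have 1: "cell_decomposable UNIV (?N \<inter> {b. divisors b \<noteq> {}}) (p + (q - p) div 2)"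
    by (rule cell_decomposable_mono) auto
  have 2: "cell_decomposable UNIV ?S (p + (q - p) div 2)"
    by (rule cell_decomposable_mono[OF decomposable_some_divisor[OF pq]]) auto
  have ae: "a i \<le> b" if "e i \<le> b" "i < p" for i b
    using a_le_e[of i] that pq by (meson order_trans order_less_le_trans)
  have "exponents = (?N \<inter> {b. divisors b \<noteq> {}}) \<union> ?S"
  proof (intro equalityI subsetI)
    fix b assume "b \<in> exponents"
    then obtain i where "i < q" "a i \<le> b" "\<forall>i<p. \<not> e i \<le> b" by (auto simp: exponents_def)
    then show "b \<in> (?N \<inter> {b. divisors b \<noteq> {}}) \<union> ?S" by (cases "i < p") (auto simp: divisors_def)
  next
    fix b assume b: "b \<in> (?N \<inter> {b. divisors b \<noteq> {}}) \<union> ?S"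
    then have "\<exists>i<q. a i \<le> b"
      using order_less_le_trans[OF _ pq] by (auto simp: divisors_def)
    moreover have "\<forall>i<p. \<not> e i \<le> b" using b ae by auto
    ultimately show "b \<in> exponents" by (simp add: exponents_def)
  qed
  moreover have "(?N \<inter> {b. divisors b \<noteq> {}}) \<inter> ?S = {}" by blast
  ultimately show ?thesis using cell_decomposable_Un[OF 1 2] by simp
qed

text \<open>
  The test vectors \<open>\<beta> T\<close> realize the Boolean lattice of subsets \<open>T\<close> of \<open>{p..<q}\<close> inside the exponent
  vectors: \<open>\<beta> T\<close> is divided by \<open>a i\<close> exactly if \<open>i \<in> T\<close>. For \<open>p = q\<close> there are no atoms to argue
  with; then it suffices that every cell, being disjoint from the multiples of \<open>e i\<close>, has to fix a
  coordinate in each of the disjoint supports.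
\<close>

theorem partition_bound:
  assumes fin: "finite P" and P: "partitions P exponents" and ne: "exponents \<noteq> {}"
    and s: "\<And>c. c \<in> P \<Longrightarrow> s \<le> card (snd c)"
  shows "s + p + (q - p) div 2 \<le> CARD('n)"
proof -
  have in_cell: "is_singleton {c \<in> P. b \<in> cell c}" if "b \<in> exponents" for b
    using P that by (rule partitions_singleton)
  have cell_sub: "b \<in> exponents" if "c \<in> P" "b \<in> cell c" for b c
    using partitions_cell_subset[OF P] that by blast
  have not_all: "\<not> supp (e i) \<subseteq> snd c" if "c \<in> P" "i < p" for c i
  proof
    assume sub: "supp (e i) \<subseteq> snd c"
    have "e i x = 0" if "x \<notin> snd c" for x using sub that by (auto simp: supp_def)
    then have "(\<lambda>x. max (fst c x) (e i x)) \<in> cell c" by (simp add: cell_def le_fun_def)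
    then have "(\<lambda>x. max (fst c x) (e i x)) \<in> exponents" by (rule cell_sub[OF that(1)])
    then show False using that(2) by (auto simp: exponents_def le_fun_def)
  qed
  define y where "y i = (SOME x. x \<in> supp (a i))" for i
  have y: "y i \<in> supp (a i)" if "i < q" for i
    unfolding y_def using a_nonzero[OF that] by (simp add: some_in_eq)
  have y_e: "y i \<in> supp (e j) \<longleftrightarrow> i = j" if "i < q" "j < q" for i j
    using y[OF that(1)] supp_a[OF that(1)] disjoint[OF that] by blast
  have inj: "inj_on y {..<q}"
  proof (rule inj_onI)
    fix i j assume ij: "i \<in> {..<q}" "j \<in> {..<q}" "y i = y j"
    then have "y i \<in> supp (e j)" using y[of j] supp_a[of j] by auto
    then show "i = j" using y_e[of i j] ij by simp
  qed
  show ?thesis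
  proof (cases "p = q")
    case True
    obtain b where "b \<in> exponents" using ne by blast
    then obtain c where c: "c \<in> P" using in_cell unfolding is_singleton_def by blast
    define z where "z i = (SOME x. x \<in> supp (e i) - snd c)" for i
    have z: "z i \<in> supp (e i) - snd c" if "i < p" for i
    proof -
      have "\<exists>x. x \<in> supp (e i) - snd c" using not_all[OF c that] by blast
      then show ?thesis unfolding z_def by (rule someI_ex)
    qed
    have "inj_on z {..<p}"
    proof (rule inj_onI, rule ccontr)
      fix i j assume ij: "i \<in> {..<p}" "j \<in> {..<p}" "z i = z j" "i \<noteq> j"
      then have "z i \<in> supp (e i) \<inter> supp (e j)" using z[of i] z[of j] by auto
      then show False using disjoint[of i j] ij True by auto
    qed
    then have "p = card (z ` {..<p})" by (simp add: card_image)
    also have "\<dots> \<le> card (- snd c)" using z by (intro card_mono) auto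
    finally have "p \<le> CARD('n) - card (snd c)" by (simp add: Compl_eq_Diff_UNIV card_Diff_subset)
    moreover have "card (snd c) \<le> CARD('n)" by (rule card_mono) auto
    ultimately show ?thesis using s[OF c] True by simp
  next
    case False
    \<comment> \<open>Larger than every coordinate that a cell or a generator can prescribe.\<close>
    define N where "N = Suc ((\<Sum>c\<in>P. \<Sum>x\<in>UNIV. fst c x) + (\<Sum>i<q. \<Sum>x\<in>UNIV. e i x))"
    have NP: "fst c x < N" if "c \<in> P" for c x
    proof -
      have "fst c x \<le> (\<Sum>x\<in>UNIV. fst c x)" by (rule member_le_sum) auto
      also have "\<dots> \<le> (\<Sum>c\<in>P. \<Sum>x\<in>UNIV. fst c x)" using that fin by (intro member_le_sum) auto
      finally show ?thesis by (simp add: N_def)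
    qed
    have Ne: "e i x < N" if "i < q" for i x
    proof -
      have "e i x \<le> (\<Sum>x\<in>UNIV. e i x)" by (rule member_le_sum) auto
      also have "\<dots> \<le> (\<Sum>i<q. \<Sum>x\<in>UNIV. e i x)" using that by (intro member_le_sum[of _ _ "\<lambda>i. \<Sum>x\<in>UNIV. e i x"]) auto
      finally show ?thesis by (simp add: N_def)
    qed
    \<comment> \<open>Truncated subtraction is harmless here: \<open>a i\<close> is positive at \<open>y i\<close>.\<close>
    define \<beta> where "\<beta> T x = (if x \<in> y ` {..<q}
      then (let i = inv_into {..<q} y x in a i x - (if i \<in> T then 0 else 1)) else N)" for T x
    have \<beta>y: "\<beta> T (y i) = a i (y i) - (if i \<in> T then 0 else 1)" if "i < q" for T i
      using that inj by (simp add: \<beta>_def inv_into_f_f)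
    have \<beta>N: "\<beta> T x = N" if "x \<notin> y ` {..<q}" for T x using that by (simp add: \<beta>_def)
    have a_\<beta>: "a i \<le> \<beta> T \<longleftrightarrow> i \<in> T" if i: "i < q" for i T
    proof
      assume "a i \<le> \<beta> T"
      then have "a i (y i) \<le> \<beta> T (y i)" by (simp add: le_fun_def)
      moreover have "a i (y i) > 0" using y[OF i] by (simp add: supp_def)
      ultimately show "i \<in> T" using \<beta>y[OF i, of T] by (auto split: if_splits)
    next
      assume T: "i \<in> T"
      show "a i \<le> \<beta> T"
      proof (rule le_funI)
        fix x
        show "a i x \<le> \<beta> T x"
        proof (cases "x \<in> y ` {..<q}")
          case True
          then obtain k where k: "k < q" "x = y k" by auto
          show ?thesis
          proof (cases "k = i")
            case True
            then show ?thesis using \<beta>y[OF i, of T] T k by simp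
          next
            case False
            then have "x \<notin> supp (a i)" using y_e[OF k(1) i] supp_a[OF i] k by auto
            then show ?thesis by (simp add: supp_def)
          qed
        next
          case False
          have "a i x \<le> e i x" using a_le_e[OF i] by (simp add: le_fun_def)
          then show ?thesis using \<beta>N[OF False, of T] Ne[OF i, of x] by simp
        qed
      qed
    qed
    have \<beta>_exp: "\<beta> T \<in> exponents \<longleftrightarrow> T \<noteq> {}" if T: "T \<subseteq> {p..<q}" for T
    proof -
      have "\<not> e i \<le> \<beta> T" if i: "i < p" for i
      proof
        assume "e i \<le> \<beta> T"
        then have "a i \<le> \<beta> T" using a_le_e[of i] i pq by (meson order_trans order_less_le_trans)
        then show False using a_\<beta>[of i T] i pq T by auto
      qed
      then show ?thesis unfolding exponents_def using a_\<beta>[of _ T] T by (auto simp: subset_iff)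
    qed
    have \<beta>_mono: "\<beta> T \<le> \<beta> T'" if "T \<subseteq> T'" for T T'
      using that by (auto simp: le_fun_def \<beta>_def Let_def)
    have \<beta>_change: "\<beta> T x = \<beta> T' x" if "\<And>i. i < q \<Longrightarrow> x = y i \<Longrightarrow> i \<in> T \<longleftrightarrow> i \<in> T'" for T T' x
    proof (cases "x \<in> y ` {..<q}")
      case True
      then obtain i where "i < q" "x = y i" by auto
      then show ?thesis using that[of i] \<beta>y[of i] by simp
    qed (simp add: \<beta>N)
    let ?R = "{p..<q}"
    define C where "C j = (SOME c. c \<in> P \<and> \<beta> {j} \<in> cell c)" for j
    have C: "C j \<in> P \<and> \<beta> {j} \<in> cell (C j)" if "j \<in> ?R" for j
      unfolding C_def
    proof (rule someI_ex)
      show "\<exists>c. c \<in> P \<and> \<beta> {j} \<in> cell c"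
        using in_cell[of "\<beta> {j}"] \<beta>_exp[of "{j}"] that unfolding is_singleton_def by auto
    qed
    \<comment> \<open>The atoms \<open>{i}\<close> such that the cell of \<open>{j}\<close> contains \<open>\<beta> {i, j}\<close> as well.\<close>
    define Out where "Out j = {i \<in> ?R - {j}. y i \<in> snd (C j)}" for j
    have up: "\<beta> T \<in> cell (C j)" if j: "j \<in> ?R" and T: "j \<in> T" "T - {j} \<subseteq> Out j" for j T
    proof -
      have "fst (C j) \<le> \<beta> {j}" using C[OF j] by (simp add: cell_def)
      also have "\<dots> \<le> \<beta> T" using T by (intro \<beta>_mono) auto
      finally have "fst (C j) \<le> \<beta> T" .
      moreover have "\<beta> T x = fst (C j) x" if x: "x \<notin> snd (C j)" for x
      proof -
        have "\<beta> T x = \<beta> {j} x" using T x by (intro \<beta>_change) (auto simp: Out_def)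
        then show ?thesis using C[OF j] x by (simp add: cell_def)
      qed
      ultimately show ?thesis by (simp add: cell_def)
    qed
    \<comment> \<open>If \<open>i\<close> and \<open>j\<close> pointed at each other, both cells would contain \<open>\<beta> {i, j}\<close>, hence coincide; such a common cell would contain \<open>\<beta> {}\<close>, which is no multiple of any \<open>a i\<close>.\<close>
    have anti: "j \<notin> Out i" if ij: "i \<in> ?R" "j \<in> ?R" "i \<in> Out j" for i j
    proof
      assume j: "j \<in> Out i"
      have "\<beta> {i, j} \<in> exponents" using \<beta>_exp[of "{i, j}"] ij by auto
      moreover have "\<beta> {i, j} \<in> cell (C i)" "\<beta> {i, j} \<in> cell (C j)"
        using up[of i "{i, j}"] up[of j "{i, j}"] ij j by auto
      ultimately have eq: "C i = C j"
        using is_singleton_Collect_unique[OF in_cell[of "\<beta> {i, j}"]] C[OF ij(1)] C[OF ij(2)] by blast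
      have "i \<noteq> j" using j by (auto simp: Out_def)
      have "fst (C j) x \<le> \<beta> {} x" for x
      proof -
        have "fst (C j) \<le> \<beta> {i}" "fst (C j) \<le> \<beta> {j}" using C[OF ij(1)] C[OF ij(2)] eq by (auto simp: cell_def)
        then have "fst (C j) x \<le> \<beta> {i} x" "fst (C j) x \<le> \<beta> {j} x" by (auto simp: le_fun_def)
        moreover have "\<beta> {} x = \<beta> {i} x \<or> \<beta> {} x = \<beta> {j} x"
        proof (cases "x = y i")
          case True
          then have "x \<noteq> y j" using inj \<open>i \<noteq> j\<close> ij by (auto simp: inj_on_def)
          then show ?thesis by (intro disjI2 \<beta>_change) auto
        qed (intro disjI1 \<beta>_change, auto)
        ultimately show ?thesis by metis
      qed
      moreover have "\<beta> {} x = fst (C j) x" if x: "x \<notin> snd (C j)" for x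
      proof -
        have "x \<noteq> y j" using x j eq by (auto simp: Out_def)
        then have "\<beta> {} x = \<beta> {j} x" by (intro \<beta>_change) auto
        then show ?thesis using C[OF ij(2)] x by (simp add: cell_def)
      qed
      ultimately have "\<beta> {} \<in> cell (C j)" by (simp add: cell_def le_fun_def)
      then have "\<beta> {} \<in> exponents" using cell_sub C[OF ij(2)] by blast
      then show False using \<beta>_exp[of "{}"] by simp
    qed
    have "\<exists>j\<in>?R. 2 * card (Out j) < card ?R"
    proof (rule oriented_graph_small_outdegree)
      show "?R \<noteq> {}" using False pq by simp
    qed (use anti in \<open>auto simp: Out_def\<close>)
    then obtain j where j: "j \<in> ?R" "2 * card (Out j) < q - p" by auto
    \<comment> \<open>All other coordinates in the support of \<open>e i\<close> are free in this cell, because there \<open>\<beta> {j}\<close> has the value \<open>N\<close>; if \<open>y i\<close> were free too, the cell would contain multiples of \<open>e i\<close>.\<close>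
    have y_notin: "y i \<notin> snd (C j)" if i: "i < p" for i
    proof
      assume yi: "y i \<in> snd (C j)"
      have "supp (e i) \<subseteq> snd (C j)"
      proof
        fix x assume x: "x \<in> supp (e i)"
        show "x \<in> snd (C j)"
        proof (cases "x \<in> y ` {..<q}")
          case True
          then show ?thesis using yi y_e[of _ i] x i pq by auto
        next
          case F: False
          show ?thesis
          proof (rule ccontr)
            assume "x \<notin> snd (C j)"
            then have "\<beta> {j} x = fst (C j) x" using C[OF j(1)] by (simp add: cell_def)
            then show False using \<beta>N[OF F, of "{j}"] NP[of "C j" x] C[OF j(1)] by simp
          qed
        qed
      qed
      then show False using not_all C[OF j(1)] i by blast
    qed
    have "snd (C j) \<subseteq> - y ` {..<q} \<union> y ` insert j (Out j)"
    proof
      fix x assume x: "x \<in> snd (C j)"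
      show "x \<in> - y ` {..<q} \<union> y ` insert j (Out j)"
      proof (cases "x \<in> y ` {..<q}")
        case True
        then obtain i where i: "i < q" "x = y i" by auto
        then have "p \<le> i" using y_notin x not_less by blast
        then have "i \<in> insert j (Out j)" using i x by (auto simp: Out_def)
        then show ?thesis using i(2) by blast
      qed simp
    qed
    then have "card (snd (C j)) \<le> card (- y ` {..<q} \<union> y ` insert j (Out j))" by (intro card_mono) auto
    also have "\<dots> \<le> card (- y ` {..<q}) + card (y ` insert j (Out j))" by (rule card_Un_le)
    also have "card (- y ` {..<q}) = CARD('n) - q" using inj by (simp add: Compl_eq_Diff_UNIV card_Diff_subset card_image)
    also have "card (y ` insert j (Out j)) \<le> card (insert j (Out j))" by (rule card_image_le) (simp add: Out_def)
    also have "\<dots> \<le> Suc (card (Out j))" by (rule card_insert_le_m1[THEN order_trans]) (auto simp: Out_def)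
    finally have "s \<le> CARD('n) - q + Suc (card (Out j))" using s[of "C j"] C[OF j(1)] by simp
    moreover have "q \<le> CARD('n)" using card_mono[of UNIV "y ` {..<q}"] inj by (simp add: card_image)
    ultimately show ?thesis using j(2) pq by simp
  qed
qed

end

section \<open>Monomial ideals\<close>

definition exponent :: "('n::finite \<Rightarrow> nat) \<Rightarrow> 'n \<Rightarrow>\<^sub>0 nat" where
  "exponent = Abs_poly_mapping"

lemma lookup_exponent [simp]: "Poly_Mapping.lookup (exponent b) = b"
  by (simp add: exponent_def)

definition monomial_span :: "('n \<Rightarrow>\<^sub>0 nat) set \<Rightarrow> ('n, 'k::zero) mpoly set" where
  "monomial_span T = {f. Poly_Mapping.keys f \<subseteq> T}"

definition multiples :: "('n \<Rightarrow>\<^sub>0 nat) set \<Rightarrow> ('n \<Rightarrow>\<^sub>0 nat) set" where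
  "multiples A = {g. \<exists>a\<in>A. Poly_Mapping.lookup a \<le> Poly_Mapping.lookup g}"

lemma le_lookup_imp_add:
  fixes a g :: "'n \<Rightarrow>\<^sub>0 nat"
  assumes "Poly_Mapping.lookup a \<le> Poly_Mapping.lookup g"
  shows "g - a + a = g"
  using assms by (intro poly_mapping_eqI) (simp add: lookup_add lookup_minus le_fun_def)

lemma multiples_iff_add: "g \<in> multiples A \<longleftrightarrow> (\<exists>a\<in>A. \<exists>h. g = h + a)"
proof
  assume "g \<in> multiples A"
  then obtain a where a: "a \<in> A" "Poly_Mapping.lookup a \<le> Poly_Mapping.lookup g"
    unfolding multiples_def by blast
  from le_lookup_imp_add[OF a(2)] have "g = (g - a) + a" by (rule sym)
  with a(1) show "\<exists>a\<in>A. \<exists>h. g = h + a" by blast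
next
  assume "\<exists>a\<in>A. \<exists>h. g = h + a"
  then obtain a h where "a \<in> A" "g = h + a" by blast
  then show "g \<in> multiples A" unfolding multiples_def
    by (intro CollectI bexI[of _ a]) (simp_all add: le_fun_def lookup_add)
qed

lemma multiples_add: "g \<in> multiples A \<Longrightarrow> h + g \<in> multiples A"
  unfolding multiples_iff_add by (elim bexE exE) (metis add.assoc)

lemma keys_mult_monomial_multiples:
  fixes f :: "('n, 'k::field) mpoly"
  assumes "a \<in> A"
  shows "Poly_Mapping.keys (Poly_Mapping.single a 1 * f) \<subseteq> multiples A"
proof
  fix g assume "g \<in> Poly_Mapping.keys (Poly_Mapping.single a 1 * f)"
  then obtain b where "g = a + b"
    using keys_mult[of "Poly_Mapping.single a 1" f] by (auto split: if_splits)
  then show "g \<in> multiples A" unfolding multiples_iff_add using assms by (metis add.commute)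
qed

lemma keys_sum_subset: "(\<And>i. i \<in> A \<Longrightarrow> Poly_Mapping.keys (f i) \<subseteq> T) \<Longrightarrow> Poly_Mapping.keys (sum f A) \<subseteq> T"
  by (rule order_trans[OF keys_sum]) (rule UN_least)

lemma monomial_span_ideal:
  fixes A :: "('n \<Rightarrow>\<^sub>0 nat) set"
  shows "ideal (monomial_span (multiples A) :: ('n, 'k::field) mpoly set) ring_of_type_algebra"
proof -
  let ?R = "ring_of_type_algebra :: ('n, 'k) mpoly ring"
  let ?T = "monomial_span (multiples A) :: ('n, 'k) mpoly set"
  interpret R: cring ?R by (rule cring_from_type_algebra)
  show ?thesis
  proof (rule idealI)
    show "ring ?R" by (rule R.ring_axioms)
    show "subgroup ?T (add_monoid ?R)"
    proof (rule group.subgroupI[OF R.a_group])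
      show "?T \<subseteq> carrier (add_monoid ?R)" by (simp add: ring_of_type_algebra_def)
      have "0 \<in> ?T" by (simp add: monomial_span_def)
      then show "?T \<noteq> {}" by blast
      fix x y assume x: "x \<in> ?T" and y: "y \<in> ?T"
      have "inv\<^bsub>add_monoid ?R\<^esub> x = - x"
        by (rule group.inv_equality[OF R.a_group]) (auto simp: ring_of_type_algebra_def)
      then show "inv\<^bsub>add_monoid ?R\<^esub> x \<in> ?T" using x
        by (auto simp: monomial_span_def in_keys_iff lookup_uminus subset_iff)
      show "x \<otimes>\<^bsub>add_monoid ?R\<^esub> y \<in> ?T" using x y Poly_Mapping.keys_add[of x y]
        by (auto simp: ring_of_type_algebra_def monomial_span_def)
    qed
    fix x y assume x: "x \<in> ?T"
    have "Poly_Mapping.keys (y * x) \<subseteq> multiples A"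
    proof
      fix g assume "g \<in> Poly_Mapping.keys (y * x)"
      then obtain b h where "g = b + h" "h \<in> Poly_Mapping.keys x" using keys_mult[of y x] by blast
      then show "g \<in> multiples A" using x multiples_add by (auto simp: monomial_span_def)
    qed
    then show "y \<otimes>\<^bsub>?R\<^esub> x \<in> ?T" "x \<otimes>\<^bsub>?R\<^esub> y \<in> ?T"
      by (simp_all add: ring_of_type_algebra_def mult.commute monomial_span_def)
  qed
qed

lemma genideal_monomials:
  fixes A :: "('n \<Rightarrow>\<^sub>0 nat) set"
  shows "genideal ring_of_type_algebra ((\<lambda>a. Poly_Mapping.single a 1) ` A) =
    (monomial_span (multiples A) :: ('n, 'k::field) mpoly set)" (is "?I = ?T")
proof -
  let ?R = "ring_of_type_algebra :: ('n, 'k) mpoly ring"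
  interpret R: cring ?R by (rule cring_from_type_algebra)
  have c: "(\<lambda>a. Poly_Mapping.single a 1) ` A \<subseteq> carrier ?R" by (simp add: ring_of_type_algebra_def)
  have I: "ideal ?I ?R" by (rule R.genideal_ideal[OF c])
  note ID = ideal_of_typeD[OF I]
  show ?thesis
  proof
    have "(\<lambda>a. Poly_Mapping.single a 1) ` A \<subseteq> ?T"
      by (auto simp: monomial_span_def multiples_def)
    then show "?I \<subseteq> ?T" by (rule R.genideal_minimal[OF monomial_span_ideal])
    show "?T \<subseteq> ?I"
    proof
      fix f :: "('n, 'k) mpoly" assume f: "f \<in> ?T"
      have "Poly_Mapping.single g (Poly_Mapping.lookup f g) \<in> ?I" if "g \<in> Poly_Mapping.keys f" for g
      proof -
        have "g \<in> multiples A" using f that by (auto simp: monomial_span_def)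
        then obtain a h where a: "a \<in> A" "g = h + a" by (auto simp: multiples_iff_add)
        have "Poly_Mapping.single a 1 \<in> ?I" using R.genideal_self[OF c] a(1) by blast
        from ID(3)[OF this, of "Poly_Mapping.single h (Poly_Mapping.lookup f g)"]
        show ?thesis by (simp add: mult_single a(2))
      qed
      moreover have sum: "sum F B \<in> ?I" if "\<And>g. g \<in> B \<Longrightarrow> F g \<in> ?I" for F :: "('n \<Rightarrow>\<^sub>0 nat) \<Rightarrow> ('n, 'k) mpoly" and B
        using that by (induction B rule: infinite_finite_induct) (auto intro: ID(1,2))
      ultimately have "(\<Sum>g\<in>Poly_Mapping.keys f. Poly_Mapping.single g (Poly_Mapping.lookup f g)) \<in> ?I"
        by (intro sum)
      then show "f \<in> ?I" by (simp add: sum_single_keys)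
    qed
  qed
qed

lemma monomials_map:
  assumes "\<forall>u\<in>set us. is_monomial u"
  obtains as where "us = map (\<lambda>a. Poly_Mapping.single a 1) as"
  using assms by (metis (full_types) ex_map_conv is_monomial_def)

lemma monomial_dvd_imp_le:
  assumes "Poly_Mapping.single a (1::'k::field) dvd Poly_Mapping.single b 1"
  shows "Poly_Mapping.lookup a \<le> Poly_Mapping.lookup (b :: 'n \<Rightarrow>\<^sub>0 nat)"
proof -
  obtain f where f: "Poly_Mapping.single b (1::'k) = Poly_Mapping.single a 1 * f" using assms by blast
  have "b \<in> Poly_Mapping.keys (Poly_Mapping.single b (1::'k))" by simp
  then have "b \<in> multiples {a}" unfolding f using keys_mult_monomial_multiples[of a "{a}" f] by blast
  then show ?thesis by (simp add: multiples_def)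
qed

section \<open>Regular sequences of monomials\<close>

lemma (in module) list_multiples_submodule:
  assumes fs: "set fs \<subseteq> carrier R"
  shows "additive_subgroup (list_multiples M fs) M"
    and "\<And>f x. f \<in> carrier R \<Longrightarrow> x \<in> list_multiples M fs \<Longrightarrow> f \<odot>\<^bsub>M\<^esub> x \<in> list_multiples M fs"
    and "\<And>l y. l < length fs \<Longrightarrow> y \<in> carrier M \<Longrightarrow> fs ! l \<odot>\<^bsub>M\<^esub> y \<in> list_multiples M fs"
    and "list_multiples M fs \<subseteq> carrier M"
proof -
  let ?N = "list_multiples M fs"
  have c: "fs ! i \<in> carrier R" if "i < length fs" for i using fs that nth_mem by blast
  have memI: "x \<in> ?N" if "h \<in> {..<length fs} \<rightarrow> carrier M"
    "x = (\<Oplus>\<^bsub>M\<^esub>i\<in>{..<length fs}. (fs ! i) \<odot>\<^bsub>M\<^esub> h i)" for x h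
    using that unfolding list_multiples_def by blast
  show sub: "?N \<subseteq> carrier M"
    using c by (auto simp: list_multiples_def intro!: finsum_closed)
  have smult: "f \<odot>\<^bsub>M\<^esub> x \<in> ?N" if fx: "f \<in> carrier R" "x \<in> ?N" for f x
  proof -
    obtain h where h: "h \<in> {..<length fs} \<rightarrow> carrier M" "x = (\<Oplus>\<^bsub>M\<^esub>i\<in>{..<length fs}. (fs ! i) \<odot>\<^bsub>M\<^esub> h i)"
      using fx(2) by (auto simp: list_multiples_def)
    have "f \<odot>\<^bsub>M\<^esub> x = (\<Oplus>\<^bsub>M\<^esub>i\<in>{..<length fs}. f \<odot>\<^bsub>M\<^esub> ((fs ! i) \<odot>\<^bsub>M\<^esub> h i))"
      unfolding h(2) by (rule finsum_smult_ldistr) (use h(1) c that in auto)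
    also have "\<dots> = (\<Oplus>\<^bsub>M\<^esub>i\<in>{..<length fs}. (fs ! i) \<odot>\<^bsub>M\<^esub> (f \<odot>\<^bsub>M\<^esub> h i))"
    proof (rule finsum_cong')
      fix i assume i: "i \<in> {..<length fs}"
      then have "h i \<in> carrier M" "fs ! i \<in> carrier R" using h(1) c by auto
      then show "f \<odot>\<^bsub>M\<^esub> ((fs ! i) \<odot>\<^bsub>M\<^esub> h i) = (fs ! i) \<odot>\<^bsub>M\<^esub> (f \<odot>\<^bsub>M\<^esub> h i)"
        using that(1) by (simp add: smult_assoc1[symmetric] R.m_comm)
    qed (use h(1) c that in auto)
    finally show ?thesis using h(1) that(1) by (intro memI) auto
  qed
  show "f \<odot>\<^bsub>M\<^esub> x \<in> ?N" if "f \<in> carrier R" "x \<in> ?N" for f x using that by (rule smult)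
  have gen: "fs ! l \<odot>\<^bsub>M\<^esub> y \<in> ?N" if "l < length fs" "y \<in> carrier M" for l y
  proof (rule memI)
    let ?h = "\<lambda>i. if i = l then y else \<zero>\<^bsub>M\<^esub>"
    show "?h \<in> {..<length fs} \<rightarrow> carrier M" using that by auto
    have "(\<Oplus>\<^bsub>M\<^esub>i\<in>{..<length fs}. (fs ! i) \<odot>\<^bsub>M\<^esub> ?h i) =
        (\<Oplus>\<^bsub>M\<^esub>i\<in>{..<length fs}. if l = i then (fs ! i) \<odot>\<^bsub>M\<^esub> y else \<zero>\<^bsub>M\<^esub>)"
      by (rule finsum_cong') (use that c in auto)
    also have "\<dots> = fs ! l \<odot>\<^bsub>M\<^esub> y"
      by (rule finsum_singleton) (use that c in auto)
    finally show "fs ! l \<odot>\<^bsub>M\<^esub> y = (\<Oplus>\<^bsub>M\<^esub>i\<in>{..<length fs}. (fs ! i) \<odot>\<^bsub>M\<^esub> ?h i)" by simp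
  qed
  show "fs ! l \<odot>\<^bsub>M\<^esub> y \<in> ?N" if "l < length fs" "y \<in> carrier M" for l y using that by (rule gen)
  show "additive_subgroup ?N M"
  proof (rule additive_subgroup.intro, rule group.subgroupI[OF a_group])
    show "?N \<subseteq> carrier (add_monoid M)" using sub by simp
    have "\<zero>\<^bsub>M\<^esub> \<in> ?N"
    proof (rule memI)
      show "(\<lambda>_. \<zero>\<^bsub>M\<^esub>) \<in> {..<length fs} \<rightarrow> carrier M" by simp
      have "(\<Oplus>\<^bsub>M\<^esub>i\<in>{..<length fs}. fs ! i \<odot>\<^bsub>M\<^esub> \<zero>\<^bsub>M\<^esub>) = (\<Oplus>\<^bsub>M\<^esub>i\<in>{..<length fs}. \<zero>\<^bsub>M\<^esub>)"
        by (rule finsum_cong') (use c in auto)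
      then show "\<zero>\<^bsub>M\<^esub> = (\<Oplus>\<^bsub>M\<^esub>i\<in>{..<length fs}. fs ! i \<odot>\<^bsub>M\<^esub> \<zero>\<^bsub>M\<^esub>)" by simp
    qed
    then show "?N \<noteq> {}" by blast
    fix x assume x: "x \<in> ?N"
    have "(\<ominus>\<^bsub>R\<^esub> \<one>\<^bsub>R\<^esub>) \<odot>\<^bsub>M\<^esub> x \<in> ?N" by (rule smult) (use x in auto)
    moreover have "(\<ominus>\<^bsub>R\<^esub> \<one>\<^bsub>R\<^esub>) \<odot>\<^bsub>M\<^esub> x = \<ominus>\<^bsub>M\<^esub> x"
      using x sub by (subst smult_l_minus) auto
    ultimately show "inv\<^bsub>add_monoid M\<^esub> x \<in> ?N" by (simp add: a_inv_def)
    fix y assume y: "y \<in> ?N"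
    obtain h where h: "h \<in> {..<length fs} \<rightarrow> carrier M" "x = (\<Oplus>\<^bsub>M\<^esub>i\<in>{..<length fs}. (fs ! i) \<odot>\<^bsub>M\<^esub> h i)"
      using x by (auto simp: list_multiples_def)
    obtain k where k: "k \<in> {..<length fs} \<rightarrow> carrier M" "y = (\<Oplus>\<^bsub>M\<^esub>i\<in>{..<length fs}. (fs ! i) \<odot>\<^bsub>M\<^esub> k i)"
      using y by (auto simp: list_multiples_def)
    have "x \<oplus>\<^bsub>M\<^esub> y = (\<Oplus>\<^bsub>M\<^esub>i\<in>{..<length fs}. (fs ! i) \<odot>\<^bsub>M\<^esub> h i \<oplus>\<^bsub>M\<^esub> (fs ! i) \<odot>\<^bsub>M\<^esub> k i)"
      unfolding h(2) k(2) by (rule finsum_addf[symmetric]) (use h k c in auto)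
    also have "\<dots> = (\<Oplus>\<^bsub>M\<^esub>i\<in>{..<length fs}. (fs ! i) \<odot>\<^bsub>M\<^esub> (h i \<oplus>\<^bsub>M\<^esub> k i))"
    proof (rule finsum_cong')
      fix i assume "i \<in> {..<length fs}"
      then have "h i \<in> carrier M" "k i \<in> carrier M" "fs ! i \<in> carrier R" using h(1) k(1) c by auto
      then show "(fs ! i) \<odot>\<^bsub>M\<^esub> h i \<oplus>\<^bsub>M\<^esub> (fs ! i) \<odot>\<^bsub>M\<^esub> k i = (fs ! i) \<odot>\<^bsub>M\<^esub> (h i \<oplus>\<^bsub>M\<^esub> k i)"
        by (simp add: smult_r_distr)
    qed (use h(1) k(1) c in auto)
    finally have "x \<oplus>\<^bsub>M\<^esub> y \<in> ?N" using h(1) k(1) by (intro memI) auto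
    then show "x \<otimes>\<^bsub>add_monoid M\<^esub> y \<in> ?N" by simp
  qed
qed

lemma (in module) nonzerodivisor_on_quotD:
  assumes N: "additive_subgroup N M" and sm: "\<And>x. x \<in> N \<Longrightarrow> f \<odot>\<^bsub>M\<^esub> x \<in> N" and f: "f \<in> carrier R"
    and nzd: "nonzerodivisor_on (quot_module M N) f"
    and x: "x \<in> carrier M" "f \<odot>\<^bsub>M\<^esub> x \<in> N"
  shows "x \<in> N"
proof -
  interpret N: additive_subgroup N M by (rule N)
  have self: "y \<in> N +>\<^bsub>M\<^esub> y" if "y \<in> carrier M" for y
    using that N.zero_closed by (auto simp: a_r_coset_def' intro!: bexI[of _ "\<zero>\<^bsub>M\<^esub>"])
  have absorb: "N +>\<^bsub>M\<^esub> y = N" if "y \<in> N" for y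
    using that a_coset_join2[of y N] N.a_subgroup N.a_subset by blast
  have "N +>\<^bsub>M\<^esub> (f \<odot>\<^bsub>M\<^esub> y) = N" if y: "y \<in> N +>\<^bsub>M\<^esub> x" for y
  proof -
    obtain n where n: "n \<in> N" "y = n \<oplus>\<^bsub>M\<^esub> x" using y by (auto simp: a_r_coset_def')
    have "f \<odot>\<^bsub>M\<^esub> y = f \<odot>\<^bsub>M\<^esub> n \<oplus>\<^bsub>M\<^esub> f \<odot>\<^bsub>M\<^esub> x"
      unfolding n(2) using n(1) N.a_Hcarr f x(1) by (intro smult_r_distr) auto
    also have "\<dots> \<in> N" using sm[OF n(1)] x(2) by (rule N.a_closed)
    finally show ?thesis by (rule absorb)
  qed
  then have "f \<odot>\<^bsub>quot_module M N\<^esub> (N +>\<^bsub>M\<^esub> x) = N"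
    using self[OF x(1)] by (auto simp: quot_module_def)
  moreover have "N +>\<^bsub>M\<^esub> x \<in> carrier (quot_module M N)"
    using x(1) by (auto simp: quot_module_def A_RCOSETS_def')
  ultimately have "N +>\<^bsub>M\<^esub> x = N"
    using nzd unfolding nonzerodivisor_on_def by (auto simp: quot_module_def)
  then show ?thesis using self[OF x(1)] by simp
qed

text \<open>
  The second part uses that the quotient by the whole sequence is nonzero: a member of the sequence equal to
  \<open>1\<close> would make it trivial.
\<close>

lemma (in module) regular_sequenceD:
  assumes reg: "regular_sequence M fs" and fs: "set fs \<subseteq> carrier R"
  shows "\<And>i x. i < length fs \<Longrightarrow> x \<in> carrier M \<Longrightarrow> fs ! i \<odot>\<^bsub>M\<^esub> x \<in> list_multiples M (take i fs) \<Longrightarrow>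
      x \<in> list_multiples M (take i fs)"
    and "\<And>i. i < length fs \<Longrightarrow> fs ! i \<noteq> \<one>\<^bsub>R\<^esub>"
proof -
  fix i assume i: "i < length fs"
  have t: "set (take i fs) \<subseteq> carrier R" using fs set_take_subset[of i fs] by blast
  have f: "fs ! i \<in> carrier R" using fs i nth_mem by blast
  show "x \<in> list_multiples M (take i fs)"
    if "x \<in> carrier M" "fs ! i \<odot>\<^bsub>M\<^esub> x \<in> list_multiples M (take i fs)" for x
    using reg i by (intro nonzerodivisor_on_quotD[OF list_multiples_submodule(1)[OF t] list_multiples_submodule(2)[OF t f] f _ that])
      (auto simp: regular_sequence_def)
  show "fs ! i \<noteq> \<one>\<^bsub>R\<^esub>"
  proof
    assume one: "fs ! i = \<one>\<^bsub>R\<^esub>"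
    let ?N = "list_multiples M fs"
    note L = list_multiples_submodule[OF fs]
    interpret N: additive_subgroup ?N M by (rule L(1))
    have all: "x \<in> ?N" if "x \<in> carrier M" for x using L(3)[OF i that] that by (simp add: one)
    have "?N +>\<^bsub>M\<^esub> x = ?N" if "x \<in> carrier M" for x
      using a_coset_join2[of x ?N] that all N.a_subgroup by blast
    then have "carrier (quot_module M ?N) = {?N}"
      using M.zero_closed unfolding quot_module_def by (auto simp: A_RCOSETS_def')
    then show False using reg by (simp add: regular_sequence_def quot_module_def)
  qed
qed

lemma module_ideal_module_UNIV:
  "module ring_of_type_algebra (ideal_module (UNIV :: 'a::comm_ring_1 set))"
proof (rule moduleI)
  show "abelian_group (ideal_module (UNIV :: 'a set))"
  proof (rule abelian_groupI)
    fix x :: 'a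
    show "\<exists>y\<in>carrier (ideal_module UNIV). y \<oplus>\<^bsub>ideal_module UNIV\<^esub> x = \<zero>\<^bsub>ideal_module UNIV\<^esub>"
      by (intro bexI[of _ "- x"]) (auto simp: ideal_module_def)
  qed (auto simp: ideal_module_def algebra_simps)
qed (rule cring_from_type_algebra, auto simp: ideal_module_def algebra_simps ring_of_type_algebra_def)

lemma finsum_ideal_module_UNIV:
  fixes f :: "'b \<Rightarrow> 'a::comm_ring_1"
  assumes "finite A"
  shows "(\<Oplus>\<^bsub>ideal_module UNIV\<^esub>i\<in>A. f i) = sum f A"
proof -
  interpret M: module ring_of_type_algebra "ideal_module (UNIV :: 'a set)" by (rule module_ideal_module_UNIV)
  have c: "carrier (ideal_module (UNIV :: 'a set)) = UNIV" by (simp add: ideal_module_def)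
  show ?thesis using assms
  proof (induction A rule: finite_induct)
    case empty
    show ?case by simp (simp add: ideal_module_def)
  next
    case (insert x F)
    then have "(\<Oplus>\<^bsub>ideal_module UNIV\<^esub>i\<in>insert x F. f i) = f x \<oplus>\<^bsub>ideal_module UNIV\<^esub> (\<Oplus>\<^bsub>ideal_module UNIV\<^esub>i\<in>F. f i)"
      by (intro M.M.finsum_insert) (auto simp: c)
    with insert show ?case by (simp add: ideal_module_def)
  qed
qed

abbreviation (input) monomial :: "('n \<Rightarrow>\<^sub>0 nat) \<Rightarrow> ('n, 'k::zero_neq_one) mpoly" where
  "monomial a \<equiv> Poly_Mapping.single a 1"

lemma list_multiples_polynomials_keys:
  fixes f :: "('n, 'k::field) mpoly"
  assumes "f \<in> list_multiples (ideal_module UNIV) (map monomial as)"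
  shows "Poly_Mapping.keys f \<subseteq> multiples (set as)"
proof -
  obtain h where h: "f = (\<Oplus>\<^bsub>ideal_module UNIV\<^esub>i\<in>{..<length as}. (map monomial as ! i) * h i)"
    using assms by (auto simp: list_multiples_def ideal_module_def)
  then have "f = (\<Sum>i<length as. (map monomial as ! i) * h i)" by (simp add: finsum_ideal_module_UNIV)
  also have "\<dots> = (\<Sum>i<length as. monomial (as ! i) * h i)" by (rule sum.cong) auto
  finally have f: "f = (\<Sum>i<length as. monomial (as ! i) * h i)" .
  show ?thesis unfolding f by (intro keys_sum_subset keys_mult_monomial_multiples) simp
qed

lemma list_multiples_quotient_keys:
  fixes f :: "('n, 'k::field) mpoly"
  assumes "I = monomial_span (multiples B)"
    and "I +>\<^bsub>ideal_module UNIV\<^esub> f \<in> list_multiples (ideal_quot UNIV I) (map monomial as)"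
  shows "Poly_Mapping.keys f \<subseteq> multiples (B \<union> set as)"
proof -
  have I: "ideal I ring_of_type_algebra" unfolding assms(1) by (rule monomial_span_ideal)
  interpret ideal_pair I "UNIV :: ('n, 'k) mpoly set"
    using ring.oneideal[OF cring.axioms(1)[OF cring_from_type_algebra]] I
    by (intro ideal_pair.intro) (auto simp: ring_of_type_algebra_def)
  interpret M: module ring_of_type_algebra "ideal_quot UNIV I" by (rule module_quot)
  let ?M = "ideal_quot UNIV I"
  obtain h where h: "h \<in> {..<length as} \<rightarrow> carrier ?M"
    "c f = (\<Oplus>\<^bsub>?M\<^esub>i\<in>{..<length as}. (map monomial as ! i) \<odot>\<^bsub>?M\<^esub> h i)"
    using assms(2) by (auto simp: list_multiples_def)
  have "\<exists>k. h i = c k" if "i < length as" for i using h(1) that by (auto simp: carrier_quot)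
  then obtain k where k: "\<And>i. i < length as \<Longrightarrow> h i = c (k i)" by metis
  have "c f = (\<Oplus>\<^bsub>?M\<^esub>i\<in>{..<length as}. c (monomial (as ! i) * k i))"
    unfolding h(2) by (rule M.M.finsum_cong') (auto simp: k smult_quot carrier_quot)
  also have "\<dots> = c (\<Sum>i<length as. monomial (as ! i) * k i)"
    by (rule finsum_quot) auto
  finally have "f - (\<Sum>i<length as. monomial (as ! i) * k i) \<in> I" unfolding coset_eq .
  then have 1: "Poly_Mapping.keys (f - (\<Sum>i<length as. monomial (as ! i) * k i)) \<subseteq> multiples (B \<union> set as)"
    unfolding assms(1) monomial_span_def by (auto simp: multiples_def)
  have 2: "Poly_Mapping.keys (\<Sum>i<length as. monomial (as ! i) * k i) \<subseteq> multiples (B \<union> set as)"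
    by (intro keys_sum_subset keys_mult_monomial_multiples) simp
  show ?thesis using 1 2 Poly_Mapping.keys_add[of "f - (\<Sum>i<length as. monomial (as ! i) * k i)" "\<Sum>i<length as. monomial (as ! i) * k i"]
    by auto
qed

text \<open>
  The nonzerodivisor condition, tested on monomials only: it says that the monomial ideal generated by
  the first \<open>i\<close> members is stable under division by the next one. The same holds in \<open>S/I\<close> below, where
  the generators of \<open>I\<close> are added to the list.
\<close>

lemma regular_polynomials_colon:
  fixes as :: "('n \<Rightarrow>\<^sub>0 nat) list"
  assumes reg: "regular_sequence (ideal_module UNIV) (map monomial as :: ('n, 'k::field) mpoly list)"
    and i: "i < length as" and w: "as ! i + w \<in> multiples (set (take i as))"
  shows "w \<in> multiples (set (take i as))"
proof -
  let ?S = "ideal_module (UNIV :: ('n, 'k) mpoly set)"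
  let ?fs = "map monomial as :: ('n, 'k) mpoly list"
  interpret M: module ring_of_type_algebra ?S by (rule module_ideal_module_UNIV)
  have c: "set fs \<subseteq> carrier (ring_of_type_algebra :: ('n, 'k) mpoly ring)" for fs
    by (simp add: ring_of_type_algebra_def)
  obtain l h where l: "l < i" "as ! i + w = h + as ! l"
    using w i by (auto simp: multiples_iff_add in_set_conv_nth)
  then have "map monomial (take i as) ! l \<odot>\<^bsub>?S\<^esub> monomial h \<in> list_multiples ?S (map monomial (take i as))"
    using i by (intro M.list_multiples_submodule(3)[OF c]) (auto simp: ideal_module_def)
  moreover have "map monomial (take i as) ! l \<odot>\<^bsub>?S\<^esub> monomial h = ?fs ! i \<odot>\<^bsub>?S\<^esub> monomial w"
    using l i by (simp add: ideal_module_def mult_single add.commute)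
  ultimately have "?fs ! i \<odot>\<^bsub>?S\<^esub> monomial w \<in> list_multiples ?S (take i ?fs)"
    by (simp add: take_map)
  then have "monomial w \<in> list_multiples ?S (take i ?fs)"
    by (rule M.regular_sequenceD(1)[OF reg c, rotated 2]) (use i in \<open>auto simp: ideal_module_def\<close>)
  then have "monomial w \<in> list_multiples ?S (map monomial (take i as))" by (simp add: take_map)
  from list_multiples_polynomials_keys[OF this] show ?thesis by simp
qed

lemma regular_polynomials_nonzero:
  fixes as :: "('n \<Rightarrow>\<^sub>0 nat) list"
  assumes reg: "regular_sequence (ideal_module UNIV) (map monomial as :: ('n, 'k::field) mpoly list)"
    and i: "i < length as"
  shows "as ! i \<noteq> 0"
proof -
  interpret M: module ring_of_type_algebra "ideal_module (UNIV :: ('n, 'k) mpoly set)"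
    by (rule module_ideal_module_UNIV)
  have "map monomial as ! i \<noteq> (\<one>\<^bsub>ring_of_type_algebra\<^esub> :: ('n, 'k) mpoly)"
    using i by (intro M.regular_sequenceD(2)[OF reg]) (auto simp: ring_of_type_algebra_def)
  then show ?thesis using i by (auto simp: ring_of_type_algebra_def)
qed

lemma regular_quotient_colon:
  fixes as :: "('n \<Rightarrow>\<^sub>0 nat) list" and I :: "('n, 'k::field) mpoly set"
  assumes I_eq: "I = monomial_span (multiples B)"
    and reg: "regular_sequence (ideal_quot UNIV I) (map monomial as)"
    and i: "i < length as" and w: "as ! i + w \<in> multiples (B \<union> set (take i as))"
  shows "w \<in> multiples (B \<union> set (take i as))"
proof -
  let ?M = "ideal_quot UNIV I"
  let ?fs = "map monomial as :: ('n, 'k) mpoly list"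
  have I: "ideal I ring_of_type_algebra" unfolding I_eq by (rule monomial_span_ideal)
  interpret ideal_pair I "UNIV :: ('n, 'k) mpoly set"
    using ring.oneideal[OF cring.axioms(1)[OF cring_from_type_algebra]] I
    by (intro ideal_pair.intro) (auto simp: ring_of_type_algebra_def)
  interpret M: module ring_of_type_algebra ?M by (rule module_quot)
  have c: "set fs \<subseteq> carrier (ring_of_type_algebra :: ('n, 'k) mpoly ring)" for fs
    by (simp add: ring_of_type_algebra_def)
  have fsi: "?fs ! i \<odot>\<^bsub>?M\<^esub> c (monomial w) = c (monomial (as ! i + w))"
    using i by (simp add: smult_quot mult_single)
  obtain b h where b: "b \<in> B \<union> set (take i as)" "as ! i + w = h + b"
    using w by (auto simp: multiples_iff_add)
  have "c (monomial (as ! i + w)) \<in> list_multiples ?M (map monomial (take i as))"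
  proof (cases "b \<in> B")
    case True
    then have "monomial (as ! i + w) \<in> I" unfolding I_eq monomial_span_def b(2)
      by (auto simp: multiples_iff_add)
    then have "c (monomial (as ! i + w)) = \<zero>\<^bsub>?M\<^esub>" by (simp add: zero_quot coset_eq)
    then show ?thesis
      using additive_subgroup.zero_closed[OF M.list_multiples_submodule(1)[OF c]] by metis
  next
    case False
    then obtain l where l: "l < i" "b = as ! l" using b(1) i by (auto simp: in_set_conv_nth)
    have "map monomial (take i as) ! l \<odot>\<^bsub>?M\<^esub> c (monomial h) \<in> list_multiples ?M (map monomial (take i as))"
      using i l by (intro M.list_multiples_submodule(3)[OF c]) (auto simp: carrier_quot)
    moreover have "map monomial (take i as) ! l \<odot>\<^bsub>?M\<^esub> c (monomial h) = c (monomial (as ! i + w))"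
      using l i unfolding b(2) by (simp add: smult_quot mult_single add.commute)
    ultimately show ?thesis by simp
  qed
  then have "?fs ! i \<odot>\<^bsub>?M\<^esub> c (monomial w) \<in> list_multiples ?M (take i ?fs)"
    unfolding fsi take_map .
  then have "c (monomial w) \<in> list_multiples ?M (take i ?fs)"
    by (rule M.regular_sequenceD(1)[OF reg c, rotated 2]) (use i in \<open>auto simp: carrier_quot\<close>)
  then have "c (monomial w) \<in> list_multiples ?M (map monomial (take i as))" by (simp add: take_map)
  from list_multiples_quotient_keys[OF I_eq this] show ?thesis by simp
qed

text \<open>
  If \<open>e l\<close> and \<open>e i\<close> share a variable, divide \<open>e l\<close> by its common factor with \<open>e i\<close>: truncated
  subtraction gives \<open>w\<close> with \<open>e l \<le> e i + w\<close>. By stability some \<open>e m\<close> with \<open>m < i\<close> divides \<open>w\<close> and so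
  \<open>e l\<close>. By induction \<open>e m\<close> and \<open>e l\<close> are coprime unless \<open>m = l\<close>, but \<open>e l\<close> does not divide the proper
  divisor \<open>w\<close> of itself.
\<close>

lemma colon_stable_imp_disjoint:
  fixes e :: "nat \<Rightarrow> 'n \<Rightarrow> nat"
  assumes nz: "\<And>i. i < q \<Longrightarrow> supp (e i) \<noteq> {}"
    and colon: "\<And>i w. i < q \<Longrightarrow> \<exists>l<i. e l \<le> (\<lambda>x. e i x + w x) \<Longrightarrow> \<exists>l<i. e l \<le> w"
    and ij: "i < q" "j < q" "i \<noteq> j"
  shows "supp (e i) \<inter> supp (e j) = {}"
proof -
  have "\<forall>l<i. supp (e l) \<inter> supp (e i) = {}" if "i < q" for i
    using that
  proof (induction i rule: less_induct)
    case (less i)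
    show ?case
    proof (intro allI impI)
      fix l assume l: "l < i"
      have "\<exists>m<i. e m \<le> (\<lambda>x. e l x - e i x)"
        by (rule colon[OF less.prems]) (use l in \<open>auto simp: le_fun_def intro!: exI[of _ l]\<close>)
      then obtain m where m: "m < i" "e m \<le> (\<lambda>x. e l x - e i x)" by blast
      have "m = l"
      proof (rule ccontr)
        assume "m \<noteq> l"
        have "supp (e m) \<inter> supp (e l) = {}"
        proof (cases "m < l")
          case True
          then show ?thesis using less.IH[of l] l less.prems by simp
        next
          case False
          then have "l < m" using \<open>m \<noteq> l\<close> by simp
          then show ?thesis using less.IH[of m] m(1) less.prems by (simp add: Int_commute)
        qed
        moreover have "e m x \<le> e l x" for x
          using le_funD[OF m(2), of x] by simp
        then have "supp (e m) \<subseteq> supp (e l)" unfolding supp_def by (metis (mono_tags, lifting) Collect_mono le_zero_eq)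
        ultimately have "supp (e m) = {}" by blast
        then show False using nz[of m] m(1) less.prems by simp
      qed
      have False if x: "e l x \<noteq> 0" "e i x \<noteq> 0" for x
        using le_funD[OF m(2), of x] x unfolding \<open>m = l\<close> by simp
      then show "supp (e l) \<inter> supp (e i) = {}" by (auto simp: supp_def)
    qed
  qed
  then show ?thesis using ij by (metis Int_commute linorder_neqE_nat)
qed

lemma lookup_mult_single:
  fixes u :: "('n, 'k::field) mpoly"
  shows "Poly_Mapping.lookup (u * Poly_Mapping.single a v) (b + a) = Poly_Mapping.lookup u b * v"
proof -
  have "u * Poly_Mapping.single a v =
      (\<Sum>g\<in>Poly_Mapping.keys u. Poly_Mapping.single g (Poly_Mapping.lookup u g)) * Poly_Mapping.single a v"
    by (simp only: sum_single_keys)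
  also have "\<dots> = (\<Sum>g\<in>Poly_Mapping.keys u. Poly_Mapping.single (g + a) (Poly_Mapping.lookup u g * v))"
    by (simp add: sum_distrib_right mult_single)
  finally show ?thesis
    by (auto simp: lookup_sum lookup_single when_def in_keys_iff sum.delta)
qed

section \<open>Stanley decompositions as partitions into cells\<close>

locale monomial_quotient = ideal_pair I J
  for I J :: "('n::finite, 'k::field) mpoly set" +
  fixes A B :: "('n \<Rightarrow>\<^sub>0 nat) set"
  assumes I_eq: "I = monomial_span (multiples B)" and J_eq: "J = monomial_span (multiples A)"
begin

abbreviation "Q \<equiv> ideal_quot J I"
abbreviation "G \<equiv> ideal_quot_grading J I"

definition basis :: "('n \<Rightarrow>\<^sub>0 nat) set" where
  "basis = multiples A - multiples B"

definition monomial_cell :: "('n \<Rightarrow>\<^sub>0 nat) \<Rightarrow> 'n set \<Rightarrow> ('n \<Rightarrow>\<^sub>0 nat) set" where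
  "monomial_cell a Z = {g. Poly_Mapping.lookup g \<in> cell (Poly_Mapping.lookup a, Z)}"

text \<open>
  The subspace of \<open>J/I\<close> spanned by the classes of monomials with exponents in \<open>T\<close>; a Stanley space is
  of this form for a cell \<open>T\<close>.
\<close>

definition coset_span :: "('n \<Rightarrow>\<^sub>0 nat) set \<Rightarrow> ('n, 'k) mpoly set set" where
  "coset_span T = c ` monomial_span T"

lemma mult_single_image:
  assumes v: "v \<noteq> (0::'k)"
  shows "(\<lambda>u. u * Poly_Mapping.single a v) ` subvar_polys Z = monomial_span (monomial_cell a Z)"
proof (intro equalityI subsetI)
  fix f assume "f \<in> (\<lambda>u. u * Poly_Mapping.single a v) ` subvar_polys Z"
  then obtain u where u: "u \<in> subvar_polys Z" "f = u * Poly_Mapping.single a v" by blast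
  have "g \<in> monomial_cell a Z" if g: "g \<in> Poly_Mapping.keys f" for g
  proof -
    obtain b where b: "b \<in> Poly_Mapping.keys u" "g = b + a"
      using g keys_mult[of u "Poly_Mapping.single a v"] unfolding u(2) by (auto split: if_splits)
    then have "Poly_Mapping.keys b \<subseteq> Z" using u(1) by (auto simp: subvar_polys_def)
    then have "Poly_Mapping.lookup b x = 0" if "x \<notin> Z" for x using that by (auto simp: in_keys_iff subset_iff)
    then show ?thesis unfolding b(2) by (simp add: monomial_cell_def cell_def le_fun_def lookup_add)
  qed
  then show "f \<in> monomial_span (monomial_cell a Z)" by (auto simp: monomial_span_def)
next
  fix f :: "('n, 'k) mpoly" assume f: "f \<in> monomial_span (monomial_cell a Z)"
  have cell: "Poly_Mapping.lookup a \<le> Poly_Mapping.lookup g"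
    "x \<notin> Z \<Longrightarrow> Poly_Mapping.lookup g x = Poly_Mapping.lookup a x" if "g \<in> Poly_Mapping.keys f" for g x
    using f that by (auto simp: monomial_span_def monomial_cell_def cell_def subset_iff)
  define u where "u = (\<Sum>g\<in>Poly_Mapping.keys f. Poly_Mapping.single (g - a) (Poly_Mapping.lookup f g / v))"
  have "Poly_Mapping.keys u \<subseteq> (\<lambda>g. g - a) ` Poly_Mapping.keys f"
    unfolding u_def by (rule keys_sum_subset) (auto split: if_splits)
  moreover have "Poly_Mapping.keys (g - a) \<subseteq> Z" if "g \<in> Poly_Mapping.keys f" for g
  proof (rule subsetI, rule ccontr)
    fix x assume "x \<in> Poly_Mapping.keys (g - a)" "x \<notin> Z"
    then show False using cell(2)[OF that, of x] by (simp add: in_keys_iff lookup_minus)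
  qed
  ultimately have "u \<in> subvar_polys Z" unfolding subvar_polys_def by blast
  moreover have "u * Poly_Mapping.single a v = f"
  proof -
    have "u * Poly_Mapping.single a v =
        (\<Sum>g\<in>Poly_Mapping.keys f. Poly_Mapping.single (g - a + a) (Poly_Mapping.lookup f g))"
      unfolding u_def sum_distrib_right using v by (simp add: mult_single)
    also have "\<dots> = (\<Sum>g\<in>Poly_Mapping.keys f. Poly_Mapping.single g (Poly_Mapping.lookup f g))"
      by (rule sum.cong) (simp_all add: le_lookup_imp_add cell(1))
    finally show ?thesis by (simp add: sum_single_keys)
  qed
  ultimately show "f \<in> (\<lambda>u. u * Poly_Mapping.single a v) ` subvar_polys Z" by blast
qed

lemma stanley_space_coset_span:
  assumes "v \<noteq> (0::'k)"
  shows "stanley_space Q (c (Poly_Mapping.single a v)) Z = coset_span (monomial_cell a Z)"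
proof -
  have "stanley_space Q (c (Poly_Mapping.single a v)) Z =
      c ` (\<lambda>u. u * Poly_Mapping.single a v) ` subvar_polys Z"
    unfolding stanley_space_def smult_quot by blast
  then show ?thesis by (simp add: mult_single_image[OF assms] coset_span_def)
qed

lemma lift_direct_summands:
  fixes r :: nat
  assumes T: "\<forall>i<r. T i \<subseteq> multiples A"
    and s: "s \<in> (\<Pi>\<^sub>E i\<in>{..<r}. coset_span (T i))"
  shows "\<exists>h. (\<forall>i<r. Poly_Mapping.keys (h i) \<subseteq> T i \<and> s i = c (h i)) \<and>
    (\<Oplus>\<^bsub>Q\<^esub>i\<in>{..<r}. s i) = c (\<Sum>i<r. h i)"
proof -
  interpret M: module ring_of_type_algebra Q by (rule module_quot)
  have "\<exists>h. Poly_Mapping.keys h \<subseteq> T i \<and> s i = c h" if "i < r" for i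
    using s that by (force simp: coset_span_def monomial_span_def PiE_iff)
  then obtain h where h: "\<And>i. i < r \<Longrightarrow> Poly_Mapping.keys (h i) \<subseteq> T i" "\<And>i. i < r \<Longrightarrow> s i = c (h i)"
    by metis
  have J: "h i \<in> J" if "i < r" for i using h(1)[OF that] T that by (auto simp: J_eq monomial_span_def)
  have "(\<Oplus>\<^bsub>Q\<^esub>i\<in>{..<r}. s i) = (\<Oplus>\<^bsub>Q\<^esub>i\<in>{..<r}. c (h i))"
    by (rule M.M.finsum_cong') (auto simp: h J carrier_quot)
  also have "\<dots> = c (\<Sum>i<r. h i)" by (rule finsum_quot) (auto simp: J)
  finally show ?thesis using h by blast
qed

definition restrict_exponents :: "('n \<Rightarrow>\<^sub>0 nat) set \<Rightarrow> ('n, 'k) mpoly \<Rightarrow> ('n, 'k) mpoly" where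
  "restrict_exponents T f = (\<Sum>g\<in>Poly_Mapping.keys f \<inter> T. Poly_Mapping.single g (Poly_Mapping.lookup f g))"

lemma lookup_restrict_exponents: "Poly_Mapping.lookup (restrict_exponents T f) g = (if g \<in> T then Poly_Mapping.lookup f g else 0)"
  unfolding restrict_exponents_def by (auto simp: lookup_sum lookup_single when_def in_keys_iff sum.delta)

lemma keys_restrict_exponents: "Poly_Mapping.keys (restrict_exponents T f) \<subseteq> T"
  by (auto simp: in_keys_iff lookup_restrict_exponents split: if_splits)

text \<open>
  The component of the class of \<open>f\<close> in the \<open>i\<close>-th summand is the class of the part of \<open>f\<close> with exponents
  in \<open>T i\<close>. Terms outside all \<open>T i\<close> lie in \<open>I\<close>, and no two different polynomials with exponents in \<open>T i\<close>
  are congruent modulo \<open>I\<close>.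
\<close>

lemma unique_cells_imp_direct_sum:
  fixes r :: nat
  assumes T: "\<And>i. i < r \<Longrightarrow> T i \<subseteq> basis" and uniq: "\<And>g. g \<in> basis \<Longrightarrow> \<exists>!i. i < r \<and> g \<in> T i"
    and x: "x \<in> carrier Q"
  shows "\<exists>!s. s \<in> (\<Pi>\<^sub>E i\<in>{..<r}. coset_span (T i)) \<and> x = (\<Oplus>\<^bsub>Q\<^esub>i\<in>{..<r}. s i)"
proof -
  have TA: "\<forall>i<r. T i \<subseteq> multiples A" using T unfolding basis_def by blast
  obtain f where f: "f \<in> J" "x = c f" using x by (auto simp: carrier_quot)
  have at: "Poly_Mapping.lookup (\<Sum>k<r. h k) g = Poly_Mapping.lookup (h i) g"
    if "\<And>k. k < r \<Longrightarrow> Poly_Mapping.keys (h k) \<subseteq> T k" "i < r" "g \<in> T i" for h :: "nat \<Rightarrow> ('n, 'k) mpoly" and i g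
  proof -
    have "Poly_Mapping.lookup (h k) g = 0" if "k \<in> {..<r} - {i}" for k
    proof -
      have "g \<notin> T k" using uniq[of g] T[OF \<open>i < r\<close>] \<open>i < r\<close> \<open>g \<in> T i\<close> that by blast
      then show ?thesis using \<open>\<And>k. k < r \<Longrightarrow> Poly_Mapping.keys (h k) \<subseteq> T k\<close>[of k] that by (auto simp: in_keys_iff subset_iff)
    qed
    then have "(\<Sum>k\<in>{..<r} - {i}. Poly_Mapping.lookup (h k) g) = 0" by simp
    moreover have "(\<Sum>k<r. Poly_Mapping.lookup (h k) g) =
        Poly_Mapping.lookup (h i) g + (\<Sum>k\<in>{..<r} - {i}. Poly_Mapping.lookup (h k) g)"
      by (rule sum.remove) (use that(2) in auto)
    ultimately show ?thesis by (simp add: lookup_sum)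
  qed
  define s0 where "s0 = (\<lambda>i\<in>{..<r}. c (restrict_exponents (T i) f))"
  have s0: "s0 \<in> (\<Pi>\<^sub>E i\<in>{..<r}. coset_span (T i))"
    using keys_restrict_exponents by (auto simp: s0_def coset_span_def monomial_span_def)
  show ?thesis
  proof (rule ex1I[of _ s0])
    interpret M: module ring_of_type_algebra Q by (rule module_quot)
    have rJ: "restrict_exponents (T i) f \<in> J" if "i < r" for i
      using keys_restrict_exponents[of "T i" f] TA that by (auto simp: J_eq monomial_span_def)
    have "(\<Oplus>\<^bsub>Q\<^esub>i\<in>{..<r}. s0 i) = (\<Oplus>\<^bsub>Q\<^esub>i\<in>{..<r}. c (restrict_exponents (T i) f))"
      by (rule M.M.finsum_cong') (auto simp: s0_def rJ carrier_quot)
    also have "\<dots> = c (\<Sum>i<r. restrict_exponents (T i) f)" by (rule finsum_quot) (auto simp: rJ)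
    also have "\<dots> = c f"
    proof -
      have "g \<in> multiples B" if g: "g \<in> Poly_Mapping.keys ((\<Sum>i<r. restrict_exponents (T i) f) - f)" for g
      proof (rule ccontr)
        assume nB: "g \<notin> multiples B"
        have "Poly_Mapping.lookup (\<Sum>i<r. restrict_exponents (T i) f) g = Poly_Mapping.lookup f g"
        proof (cases "g \<in> multiples A")
          case True
          then have "g \<in> basis" using nB by (simp add: basis_def)
          then obtain i where i: "i < r" "g \<in> T i" using uniq by blast
          have "Poly_Mapping.lookup (\<Sum>i<r. restrict_exponents (T i) f) g = Poly_Mapping.lookup (restrict_exponents (T i) f) g"
            by (rule at) (use keys_restrict_exponents i in auto)
          then show ?thesis using i by (simp add: lookup_restrict_exponents)
        next
          case False
          then have "Poly_Mapping.lookup f g = 0" using f(1) by (auto simp: J_eq monomial_span_def in_keys_iff subset_iff)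
          then show ?thesis by (simp add: lookup_sum lookup_restrict_exponents cong: if_cong)
        qed
        then show False using g by (simp add: in_keys_iff lookup_minus)
      qed
      then show ?thesis unfolding coset_eq by (auto simp: I_eq monomial_span_def)
    qed
    finally show "s0 \<in> (\<Pi>\<^sub>E i\<in>{..<r}. coset_span (T i)) \<and> x = (\<Oplus>\<^bsub>Q\<^esub>i\<in>{..<r}. s0 i)"
      using s0 f(2) by simp
  next
    fix s assume s: "s \<in> (\<Pi>\<^sub>E i\<in>{..<r}. coset_span (T i)) \<and> x = (\<Oplus>\<^bsub>Q\<^esub>i\<in>{..<r}. s i)"
    from lift_direct_summands[OF TA conjunct1[OF s]] obtain h
      where h0: "\<forall>i<r. Poly_Mapping.keys (h i) \<subseteq> T i \<and> s i = c (h i)"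
        "(\<Oplus>\<^bsub>Q\<^esub>i\<in>{..<r}. s i) = c (\<Sum>i<r. h i)" by (elim exE conjE)
    have h: "\<And>i. i < r \<Longrightarrow> Poly_Mapping.keys (h i) \<subseteq> T i" "\<And>i. i < r \<Longrightarrow> s i = c (h i)"
        "(\<Oplus>\<^bsub>Q\<^esub>i\<in>{..<r}. s i) = c (\<Sum>i<r. h i)" using h0 by auto
    have "c (\<Sum>i<r. h i) = c f" using s f(2) h(3) by simp
    then have diff: "(\<Sum>i<r. h i) - f \<in> I" unfolding coset_eq .
    have "s i = s0 i" if i: "i < r" for i
    proof -
      have "h i = restrict_exponents (T i) f"
      proof (rule poly_mapping_eqI)
        fix g
        show "Poly_Mapping.lookup (h i) g = Poly_Mapping.lookup (restrict_exponents (T i) f) g"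
        proof (cases "g \<in> T i")
          case True
          then have "g \<notin> multiples B" using T[OF i] by (auto simp: basis_def)
          then have "Poly_Mapping.lookup ((\<Sum>i<r. h i) - f) g = 0"
            using diff by (auto simp: I_eq monomial_span_def in_keys_iff subset_iff)
          then show ?thesis using at[OF h(1) i True] True by (simp add: lookup_minus lookup_restrict_exponents)
        next
          case False
          then show ?thesis using h(1)[OF i] by (auto simp: lookup_restrict_exponents in_keys_iff subset_iff)
        qed
      qed
      then show ?thesis using h(2)[OF i] i by (simp add: s0_def)
    qed
    then show "s = s0" using s s0 by (intro PiE_ext[of s "{..<r}" _ s0]) auto
  qed
qed

text \<open>
  The class of a basis monomial must occur in some summand, and occurring in two of them it would have
  two different decompositions.
\<close>

lemma direct_sum_imp_unique_cells:
  fixes r :: nat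
  assumes T: "\<And>i. i < r \<Longrightarrow> T i \<subseteq> basis"
    and dec: "\<And>x. x \<in> carrier Q \<Longrightarrow> \<exists>!s. s \<in> (\<Pi>\<^sub>E i\<in>{..<r}. coset_span (T i)) \<and> x = (\<Oplus>\<^bsub>Q\<^esub>i\<in>{..<r}. s i)"
    and g: "g \<in> basis"
  shows "\<exists>!i. i < r \<and> g \<in> T i"
proof -
  interpret M: module ring_of_type_algebra Q by (rule module_quot)
  have TA: "\<forall>i<r. T i \<subseteq> multiples A" using T unfolding basis_def by blast
  let ?x = "monomial g :: ('n, 'k) mpoly"
  have xJ: "?x \<in> J" and xI: "?x \<notin> I" using g by (auto simp: J_eq I_eq monomial_span_def basis_def)
  have xc: "c ?x \<in> carrier Q" using xJ by (simp add: carrier_quot)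
  have "\<exists>i. i < r \<and> g \<in> T i"
  proof (rule ccontr)
    assume n: "\<not> ?thesis"
    obtain s where s: "s \<in> (\<Pi>\<^sub>E i\<in>{..<r}. coset_span (T i))" "c ?x = (\<Oplus>\<^bsub>Q\<^esub>i\<in>{..<r}. s i)"
      using ex1_implies_ex[OF dec[OF xc]] by (elim exE conjE)
    from lift_direct_summands[OF TA s(1)] obtain h
      where h0: "\<forall>i<r. Poly_Mapping.keys (h i) \<subseteq> T i \<and> s i = c (h i)"
        "(\<Oplus>\<^bsub>Q\<^esub>i\<in>{..<r}. s i) = c (\<Sum>i<r. h i)" by (elim exE conjE)
    have h: "\<And>i. i < r \<Longrightarrow> Poly_Mapping.keys (h i) \<subseteq> T i" "c ?x = c (\<Sum>i<r. h i)"
      using h0 s(2) by auto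
    have "Poly_Mapping.lookup (h i) g = 0" if "i < r" for i
      using h(1)[OF that] n that by (auto simp: in_keys_iff subset_iff)
    then have "Poly_Mapping.lookup (\<Sum>i<r. h i) g = 0" by (simp add: lookup_sum)
    then have "g \<in> Poly_Mapping.keys (?x - (\<Sum>i<r. h i))" by (simp add: in_keys_iff lookup_minus)
    moreover have "?x - (\<Sum>i<r. h i) \<in> I" using h(2) coset_eq by blast
    ultimately have "g \<in> multiples B" by (auto simp: I_eq monomial_span_def)
    then show False using g by (simp add: basis_def)
  qed
  moreover have "i = j" if i: "i < r" "g \<in> T i" and j: "j < r" "g \<in> T j" for i j
  proof (rule ccontr)
    assume ne: "i \<noteq> j"
    define s where "s m = (\<lambda>k\<in>{..<r}. if m = k then c ?x else \<zero>\<^bsub>Q\<^esub>)" for m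
    have s: "s m \<in> (\<Pi>\<^sub>E i\<in>{..<r}. coset_span (T i)) \<and> c ?x = (\<Oplus>\<^bsub>Q\<^esub>i\<in>{..<r}. s m i)"
      if m: "m < r" "g \<in> T m" for m
    proof
      have "c ?x \<in> coset_span (T m)" "\<And>k. \<zero>\<^bsub>Q\<^esub> \<in> coset_span (T k)"
        using m(2) by (auto simp: coset_span_def monomial_span_def zero_quot)
      then show "s m \<in> (\<Pi>\<^sub>E i\<in>{..<r}. coset_span (T i))" by (auto simp: s_def)
      have "(\<Oplus>\<^bsub>Q\<^esub>i\<in>{..<r}. s m i) = (\<Oplus>\<^bsub>Q\<^esub>i\<in>{..<r}. if m = i then c ?x else \<zero>\<^bsub>Q\<^esub>)"
        by (rule M.M.finsum_cong') (use xc in \<open>auto simp: s_def\<close>)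
      also have "\<dots> = c ?x" by (rule M.M.finsum_singleton) (use m xc in auto)
      finally show "c ?x = (\<Oplus>\<^bsub>Q\<^esub>i\<in>{..<r}. s m i)" by simp
    qed
    obtain s' where s': "\<forall>y. y \<in> (\<Pi>\<^sub>E i\<in>{..<r}. coset_span (T i)) \<and> c ?x = (\<Oplus>\<^bsub>Q\<^esub>i\<in>{..<r}. y i) \<longrightarrow> y = s'"
      using dec[OF xc] by (elim ex1E) (rule that)
    have "s i = s j" using s'[rule_format, OF s[OF i]] s'[rule_format, OF s[OF j]] by simp
    then have "s i i = s j i" by simp
    then have "c ?x = \<zero>\<^bsub>Q\<^esub>" using i ne by (simp add: s_def)
    then show False using xI by (simp add: zero_quot coset_eq)
  qed
  ultimately show ?thesis by blast
qed

text \<open>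
  Multiplication with a monomial maps the terms of \<open>u\<close> injectively to terms in the cell, so freeness
  fails exactly if one of these monomials lies in \<open>I\<close>.
\<close>

lemma free_iff_cell_subset:
  assumes v: "v \<noteq> (0::'k)" and a: "a \<in> multiples A"
  shows "(\<forall>u\<in>subvar_polys Z. u \<odot>\<^bsub>Q\<^esub> c (Poly_Mapping.single a v) = \<zero>\<^bsub>Q\<^esub> \<longrightarrow> u = 0) \<longleftrightarrow>
    monomial_cell a Z \<subseteq> basis"
proof
  assume free: "\<forall>u\<in>subvar_polys Z. u \<odot>\<^bsub>Q\<^esub> c (Poly_Mapping.single a v) = \<zero>\<^bsub>Q\<^esub> \<longrightarrow> u = 0"
  show "monomial_cell a Z \<subseteq> basis"
  proof
    fix g assume g: "g \<in> monomial_cell a Z"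
    then have "monomial g \<in> (monomial_span (monomial_cell a Z) :: ('n, 'k) mpoly set)"
      by (simp add: monomial_span_def)
    then obtain u where u: "u \<in> subvar_polys Z" "monomial g = u * Poly_Mapping.single a v"
      unfolding mult_single_image[OF v, symmetric] by blast
    have "monomial g \<noteq> (0 :: ('n, 'k) mpoly)" by (metis lookup_single_eq lookup_zero zero_neq_one)
    then have "u \<noteq> 0" using u(2) by auto
    then have "monomial g \<notin> I" using free u by (auto simp: smult_quot zero_quot coset_eq)
    then have "g \<notin> multiples B" by (auto simp: I_eq monomial_span_def)
    moreover have "g \<in> multiples A"
      using multiples_add[OF a, of "g - a"] g le_lookup_imp_add[of a g]
      by (simp add: monomial_cell_def cell_def)
    ultimately show "g \<in> basis" by (simp add: basis_def)
  qed
next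
  assume sub: "monomial_cell a Z \<subseteq> basis"
  show "\<forall>u\<in>subvar_polys Z. u \<odot>\<^bsub>Q\<^esub> c (Poly_Mapping.single a v) = \<zero>\<^bsub>Q\<^esub> \<longrightarrow> u = 0"
  proof (intro ballI impI)
    fix u :: "('n, 'k) mpoly"
    assume u: "u \<in> subvar_polys Z" and z: "u \<odot>\<^bsub>Q\<^esub> c (Poly_Mapping.single a v) = \<zero>\<^bsub>Q\<^esub>"
    have "u * Poly_Mapping.single a v \<in> monomial_span (monomial_cell a Z)"
      using u mult_single_image[OF v] by blast
    moreover have "u * Poly_Mapping.single a v \<in> I" using z by (simp add: smult_quot zero_quot coset_eq)
    ultimately have "Poly_Mapping.keys (u * Poly_Mapping.single a v) \<subseteq> {}"
      using sub unfolding I_eq monomial_span_def basis_def by blast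
    then have "u * Poly_Mapping.single a v = 0" by simp
    then have "Poly_Mapping.lookup u b * v = 0" for b
      using lookup_mult_single[of u a v b] by simp
    then show "u = 0" using v by (intro poly_mapping_eqI) simp
  qed
qed

lemma stanley_decomposition_of_cells:
  assumes E: "\<And>g. g \<in> basis \<Longrightarrow> \<exists>!i. i < length E \<and> g \<in> monomial_cell (fst (E ! i)) (snd (E ! i))"
    and sub: "\<And>a Z. (a, Z) \<in> set E \<Longrightarrow> monomial_cell a Z \<subseteq> basis"
  shows "stanley_decomposition Q G (map (\<lambda>(a, Z). (c (monomial a), Z)) E)"
proof -
  let ?D = "map (\<lambda>(a, Z). (c (monomial a), Z)) E"
  have a: "a \<in> multiples A" if "(a, Z) \<in> set E" for a Z
    using sub[OF that] by (auto simp: monomial_cell_def cell_def basis_def)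
  have T: "monomial_cell (fst (E ! i)) (snd (E ! i)) \<subseteq> basis" if "i < length E" for i
    by (rule sub) (use nth_mem[OF that] in simp)
  have space: "stanley_space Q (fst (?D ! i)) (snd (?D ! i)) = coset_span (monomial_cell (fst (E ! i)) (snd (E ! i)))"
    if "i < length E" for i
    using that stanley_space_coset_span[of 1] by (simp add: case_prod_beta)
  have PiE: "(\<Pi>\<^sub>E i\<in>{..<length ?D}. stanley_space Q (fst (?D ! i)) (snd (?D ! i))) =
      (\<Pi>\<^sub>E i\<in>{..<length E}. coset_span (monomial_cell (fst (E ! i)) (snd (E ! i))))"
    by (rule PiE_cong[THEN trans]) (use space in auto)
  show ?thesis unfolding stanley_decomposition_def
  proof (intro conjI)
    show "\<forall>(m, Z)\<in>set ?D. m \<in> carrier Q \<and> (\<exists>d. m \<in> G d) \<and>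
        (\<forall>u\<in>subvar_polys Z. u \<odot>\<^bsub>Q\<^esub> m = \<zero>\<^bsub>Q\<^esub> \<longrightarrow> u = 0)"
    proof
      fix mZ assume "mZ \<in> set ?D"
      then obtain a Z where aZ: "(a, Z) \<in> set E" "mZ = (c (monomial a), Z)" by auto
      have J: "monomial a \<in> J" using a[OF aZ(1)] by (simp add: J_eq monomial_span_def)
      have "monomial a \<in> (mpoly_component (deg_of a) :: ('n, 'k) mpoly set)" by (auto simp: mpoly_component_deg_of)
      then have "c (monomial a) \<in> G (deg_of a)" using J by (auto simp: ideal_quot_grading_def)
      moreover have "\<forall>u\<in>subvar_polys Z. u \<odot>\<^bsub>Q\<^esub> c (monomial a) = \<zero>\<^bsub>Q\<^esub> \<longrightarrow> u = 0"
        using free_iff_cell_subset[OF one_neq_zero a[OF aZ(1)]] sub[OF aZ(1)] by blast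
      ultimately show "case mZ of (m, Z) \<Rightarrow> m \<in> carrier Q \<and> (\<exists>d. m \<in> G d) \<and>
        (\<forall>u\<in>subvar_polys Z. u \<odot>\<^bsub>Q\<^esub> m = \<zero>\<^bsub>Q\<^esub> \<longrightarrow> u = 0)"
        using J unfolding aZ(2) by (auto simp: carrier_quot)
    qed
    show "\<forall>x\<in>carrier Q. \<exists>!s. s \<in> (\<Pi>\<^sub>E i\<in>{..<length ?D}. stanley_space Q (fst (?D ! i)) (snd (?D ! i))) \<and>
        x = (\<Oplus>\<^bsub>Q\<^esub>i\<in>{..<length ?D}. s i)"
      unfolding PiE unfolding length_map
      by (rule ballI) (rule unique_cells_imp_direct_sum[OF T E])
  qed
qed

text \<open>
  Freeness excludes \<open>m = 0\<close>, and the homogeneous component of degree \<open>d\<close> is at most one-dimensional,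
  so each generator is the class of a nonzero multiple of one monomial.
\<close>

lemma cells_of_stanley_decomposition:
  assumes D: "stanley_decomposition Q G D"
  shows "\<exists>\<alpha>. (\<forall>i<length D. monomial_cell (\<alpha> i) (snd (D ! i)) \<subseteq> basis) \<and>
    (\<forall>g\<in>basis. \<exists>!i. i < length D \<and> g \<in> monomial_cell (\<alpha> i) (snd (D ! i)))"
proof -
  have "\<exists>a v. v \<noteq> 0 \<and> a \<in> multiples A \<and> fst (D ! i) = c (Poly_Mapping.single a v)" if i: "i < length D" for i
  proof -
    obtain m Z where mZ: "D ! i = (m, Z)" by (cases "D ! i")
    then have "(m, Z) \<in> set D" using nth_mem[OF i] by simp
    with D have "case (m, Z) of (m, Z) \<Rightarrow> m \<in> carrier Q \<and> (\<exists>d. m \<in> G d) \<and>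
        (\<forall>u\<in>subvar_polys Z. u \<odot>\<^bsub>Q\<^esub> m = \<zero>\<^bsub>Q\<^esub> \<longrightarrow> u = 0)"
      unfolding stanley_decomposition_def by (elim conjE bspec)
    then obtain d where d: "m \<in> G d" "\<forall>u\<in>subvar_polys Z. u \<odot>\<^bsub>Q\<^esub> m = \<zero>\<^bsub>Q\<^esub> \<longrightarrow> u = 0"
      unfolding prod.case by (elim conjE exE)
    then obtain f where f: "m = c f" "f \<in> J" "f \<in> mpoly_component d" by (auto simp: ideal_quot_grading_def)
    have "f \<noteq> 0"
    proof
      assume "f = 0"
      then have "1 \<odot>\<^bsub>Q\<^esub> m = \<zero>\<^bsub>Q\<^esub>" by (simp add: f(1) smult_quot zero_quot)
      moreover have "1 \<in> (subvar_polys Z :: ('n, 'k) mpoly set)"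
        by (auto simp: subvar_polys_def in_keys_iff lookup_one when_def split: if_splits)
      ultimately show False using d(2) by force
    qed
    then obtain a where "d = deg_of a" using mpoly_component_not_deg_of f(3) by blast
    then obtain v where v: "f = Poly_Mapping.single a v" using f(3) mpoly_component_deg_of by blast
    then have "v \<noteq> 0" using \<open>f \<noteq> 0\<close> by auto
    moreover have "a \<in> multiples A" using f(2) \<open>v \<noteq> 0\<close> by (simp add: v J_eq monomial_span_def)
    ultimately show ?thesis using f(1) v mZ by auto
  qed
  then obtain \<alpha> \<nu> where \<alpha>: "\<And>i. i < length D \<Longrightarrow> \<nu> i \<noteq> 0" "\<And>i. i < length D \<Longrightarrow> \<alpha> i \<in> multiples A"
    "\<And>i. i < length D \<Longrightarrow> fst (D ! i) = c (Poly_Mapping.single (\<alpha> i) (\<nu> i))" by metis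
  have sub: "monomial_cell (\<alpha> i) (snd (D ! i)) \<subseteq> basis" if i: "i < length D" for i
  proof -
    have "\<forall>u\<in>subvar_polys (snd (D ! i)). u \<odot>\<^bsub>Q\<^esub> fst (D ! i) = \<zero>\<^bsub>Q\<^esub> \<longrightarrow> u = 0"
      using D nth_mem[OF i] unfolding stanley_decomposition_def by (simp add: case_prod_beta)
    then show ?thesis using free_iff_cell_subset[OF \<alpha>(1)[OF i] \<alpha>(2)[OF i]] \<alpha>(3)[OF i] by simp
  qed
  have space: "stanley_space Q (fst (D ! i)) (snd (D ! i)) = coset_span (monomial_cell (\<alpha> i) (snd (D ! i)))"
    if "i < length D" for i
    using \<alpha>(3)[OF that] stanley_space_coset_span[OF \<alpha>(1)[OF that]] by simp
  then have PiE: "(\<Pi>\<^sub>E i\<in>{..<length D}. stanley_space Q (fst (D ! i)) (snd (D ! i))) =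
      (\<Pi>\<^sub>E i\<in>{..<length D}. coset_span (monomial_cell (\<alpha> i) (snd (D ! i))))"
    by (intro PiE_cong) auto
  have dec: "\<forall>x\<in>carrier Q. \<exists>!s. s \<in> (\<Pi>\<^sub>E i\<in>{..<length D}. coset_span (monomial_cell (\<alpha> i) (snd (D ! i)))) \<and>
      x = (\<Oplus>\<^bsub>Q\<^esub>i\<in>{..<length D}. s i)"
    using D unfolding stanley_decomposition_def PiE by (rule conjunct2)
  have uniq: "\<exists>!i. i < length D \<and> g \<in> monomial_cell (\<alpha> i) (snd (D ! i))" if g: "g \<in> basis" for g
    by (rule direct_sum_imp_unique_cells[OF sub bspec[OF dec] g])
  show ?thesis by (intro exI[of _ \<alpha>] conjI allI ballI impI) (erule sub, erule uniq)
qed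

end

lemma multiples_take_iff:
  assumes "i \<le> length cs"
  shows "g \<in> multiples (set (take i cs)) \<longleftrightarrow> (\<exists>l<i. Poly_Mapping.lookup (cs ! l) \<le> Poly_Mapping.lookup g)"
proof -
  have "set (take i cs) = (\<lambda>l. cs ! l) ` {..<i}" using assms by (simp add: nth_image[symmetric] lessThan_atLeast0)
  then show ?thesis by (auto simp: multiples_def)
qed

lemma multiples_set_iff:
  "g \<in> multiples (set cs) \<longleftrightarrow> (\<exists>l<length cs. Poly_Mapping.lookup (cs ! l) \<le> Poly_Mapping.lookup g)"
  using multiples_take_iff[of "length cs" cs g] by simp

lemma supp_lookup_nonempty: "a \<noteq> 0 \<Longrightarrow> supp (Poly_Mapping.lookup a) \<noteq> {}"
  by (auto simp: supp_def intro: poly_mapping_eqI)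

section \<open>The Stanley depth\<close>

lemma regular_imp_divided_disjoint:
  fixes as bs :: "('n::finite \<Rightarrow>\<^sub>0 nat) list"
  assumes pq: "p \<le> q" and len: "length as = q" "length bs = p"
    and reg_a: "regular_sequence (ideal_module UNIV) (map monomial as :: ('n, 'k::field) mpoly list)"
    and reg_b: "regular_sequence (ideal_module UNIV) (map monomial bs :: ('n, 'k) mpoly list)"
    and reg_q: "regular_sequence (ideal_quot UNIV (monomial_span (multiples (set bs))))
      (map monomial (drop p as) :: ('n, 'k) mpoly list)"
    and le: "\<And>i. i < p \<Longrightarrow> Poly_Mapping.lookup (as ! i) \<le> Poly_Mapping.lookup (bs ! i)"
  shows "divided_disjoint_monomials (\<lambda>i. Poly_Mapping.lookup (as ! i))
    (\<lambda>i. Poly_Mapping.lookup ((bs @ drop p as) ! i)) p q"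
proof -
  let ?cs = "bs @ drop p as"
  have cs: "length ?cs = q" using len pq by simp
  have nth: "?cs ! i = (if i < p then bs ! i else as ! i)" if "i < q" for i
    using that len by (simp add: nth_append)
  have a_le: "Poly_Mapping.lookup (as ! i) \<le> Poly_Mapping.lookup (?cs ! i)" if "i < q" for i
    using le[of i] nth[OF that] by simp
  have nz: "supp (Poly_Mapping.lookup (as ! i)) \<noteq> {}" if "i < q" for i
    using regular_polynomials_nonzero[OF reg_a] that len by (intro supp_lookup_nonempty) simp
  have nz': "supp (Poly_Mapping.lookup (?cs ! i)) \<noteq> {}" if i: "i < q" for i
  proof -
    obtain x where "Poly_Mapping.lookup (as ! i) x \<noteq> 0" using nz[OF i] by (auto simp: supp_def)
    then have "Poly_Mapping.lookup (?cs ! i) x \<noteq> 0" using le_funD[OF a_le[OF i], of x] by simp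
    then show ?thesis by (auto simp: supp_def)
  qed
  have colon: "\<exists>l<i. Poly_Mapping.lookup (?cs ! l) \<le> w"
    if i: "i < q" and w: "\<exists>l<i. Poly_Mapping.lookup (?cs ! l) \<le> (\<lambda>x. Poly_Mapping.lookup (?cs ! i) x + w x)" for i w
  proof -
    have "Poly_Mapping.lookup (?cs ! i + exponent w) = (\<lambda>x. Poly_Mapping.lookup (?cs ! i) x + w x)"
      by (simp add: fun_eq_iff lookup_add)
    then have m: "?cs ! i + exponent w \<in> multiples (set (take i ?cs))"
      using w i cs by (subst multiples_take_iff) simp_all
    have "exponent w \<in> multiples (set (take i ?cs))"
    proof (cases "i < p")
      case True
      then have "take i ?cs = take i bs" "?cs ! i = bs ! i" using len by (auto simp: nth_append)
      then show ?thesis using regular_polynomials_colon[OF reg_b, of i "exponent w"] m True len by simp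
    next
      case False
      then have 1: "set (take i ?cs) = set bs \<union> set (take (i - p) (drop p as))" "?cs ! i = drop p as ! (i - p)"
        using len i by (auto simp: nth_append)
      have 2: "i - p < length (drop p as)" using False i len by simp
      show ?thesis
        using regular_quotient_colon[OF refl reg_q 2, of "exponent w"] m unfolding 1 by blast
    qed
    then show ?thesis using i cs by (subst (asm) multiples_take_iff) simp_all
  qed
  show ?thesis
  proof
    show "p \<le> q" by (rule pq)
    show "supp (Poly_Mapping.lookup (as ! i)) \<noteq> {}" if "i < q" for i by (rule nz[OF that])
    show "Poly_Mapping.lookup (as ! i) \<le> Poly_Mapping.lookup (?cs ! i)" if "i < q" for i by (rule a_le[OF that])
    show "Poly_Mapping.lookup (as ! i) = Poly_Mapping.lookup (?cs ! i)" if "p \<le> i" "i < q" for i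
      using nth that by simp
    show "supp (Poly_Mapping.lookup (?cs ! i)) \<inter> supp (Poly_Mapping.lookup (?cs ! j)) = {}"
      if "i < q" "j < q" "i \<noteq> j" for i j
      using nz' colon that by (rule colon_stable_imp_disjoint)
  qed
qed

text \<open>
  The passage from partitions of exponent vectors, indexed by sets of cells, to lists of Stanley spaces. A
  cell of codimension at most \<open>n - d\<close> has at least \<open>d\<close> free variables.
\<close>

lemma (in monomial_quotient) sdepth_eq:
  assumes E_iff: "\<And>g. g \<in> basis \<longleftrightarrow> Poly_Mapping.lookup g \<in> E" and ne: "E \<noteq> {}"
    and lower: "cell_decomposable UNIV E (CARD('n) - d)" and d: "d \<le> CARD('n)"
    and upper: "\<And>P s. finite P \<Longrightarrow> partitions P E \<Longrightarrow> (\<And>c. c \<in> P \<Longrightarrow> s \<le> card (snd c)) \<Longrightarrow> s \<le> d"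
  shows "sdepth Q G = d"
proof -
  have le: "sdepth_decomp D \<le> d" if D: "stanley_decomposition Q G D" for D
  proof -
    obtain \<alpha> where \<alpha>: "\<forall>i<length D. monomial_cell (\<alpha> i) (snd (D ! i)) \<subseteq> basis"
        "\<forall>g\<in>basis. \<exists>!i. i < length D \<and> g \<in> monomial_cell (\<alpha> i) (snd (D ! i))"
      using cells_of_stanley_decomposition[OF D] by (elim exE conjE)
    note sub = \<alpha>(1)[rule_format] and uniq = \<alpha>(2)[rule_format]
    let ?c = "\<lambda>i. (Poly_Mapping.lookup (\<alpha> i), snd (D ! i))"
    let ?P = "?c ` {..<length D}"
    have cell: "b \<in> cell (?c i) \<longleftrightarrow> exponent b \<in> monomial_cell (\<alpha> i) (snd (D ! i))" for b i
      by (simp add: monomial_cell_def)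
    have "partitions ?P E"
      unfolding partitions_def
    proof
      fix b
      show "if b \<in> E then is_singleton {c \<in> ?P. b \<in> cell c} else {c \<in> ?P. b \<in> cell c} = {}"
      proof (cases "b \<in> E")
        case True
        then have "exponent b \<in> basis" using E_iff by simp
        from uniq[OF this] obtain i where i: "i < length D" "b \<in> cell (?c i)"
          "\<And>j. j < length D \<Longrightarrow> b \<in> cell (?c j) \<Longrightarrow> j = i" unfolding cell[symmetric] by blast
        then have "{c \<in> ?P. b \<in> cell c} = {?c i}" by blast
        then show ?thesis using True by (simp add: is_singleton_altdef)
      next
        case False
        then have "exponent b \<notin> basis" using E_iff by simp
        then have "\<not> b \<in> cell (?c i)" if "i < length D" for i using sub[OF that] cell by blast
        then show ?thesis using False by auto
      qed
    qed
    moreover have "sdepth_decomp D \<le> card (snd c)" if c: "c \<in> ?P" for c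
    proof -
      obtain i where i: "i < length D" "c = ?c i" using c by blast
      have "card (snd (D ! i)) \<in> (\<lambda>(m, Z). card Z) ` set D"
        using nth_mem[OF i(1)] by (force simp: case_prod_beta)
      then show ?thesis unfolding sdepth_decomp_def i(2) by (simp add: Min_le)
    qed
    ultimately show ?thesis by (intro upper[of ?P]) auto
  qed
  obtain P where P: "finite P" "partitions P E" "\<forall>(a, Z)\<in>P. card (- Z) \<le> CARD('n) - d"
    using lower unfolding cell_decomposable_def by blast
  obtain L where L: "set L = P" "distinct L" using finite_distinct_list[OF P(1)] by blast
  let ?E = "map (\<lambda>(a, Z). (exponent a, Z)) L"
  let ?D = "map (\<lambda>(a, Z). (c (monomial a), Z)) ?E"
  have cell: "g \<in> monomial_cell (fst (?E ! i)) (snd (?E ! i)) \<longleftrightarrow> Poly_Mapping.lookup g \<in> cell (L ! i)"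
    if "i < length L" for g i
    using that by (simp add: monomial_cell_def case_prod_beta)
  have "stanley_decomposition Q G ?D"
  proof (rule stanley_decomposition_of_cells)
    fix g assume "g \<in> basis"
    then have sing: "is_singleton {k \<in> P. Poly_Mapping.lookup g \<in> cell k}"
      using partitions_singleton[OF P(2)] E_iff by simp
    then obtain k where k: "{k \<in> P. Poly_Mapping.lookup g \<in> cell k} = {k}" by (rule is_singletonE)
    then have kP: "k \<in> P" "Poly_Mapping.lookup g \<in> cell k" by blast+
    then obtain i where i: "i < length L" "L ! i = k" using L(1) by (metis in_set_conv_nth)
    have uniq: "j = i" if j: "j < length L" "Poly_Mapping.lookup g \<in> cell (L ! j)" for j
    proof -
      have "L ! j \<in> P" using j(1) L(1) nth_mem by blast
      then have "L ! j = L ! i"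
        using is_singleton_Collect_unique[OF sing _ _ kP] j(2) i(2) by blast
      then show ?thesis using nth_eq_iff_index_eq[OF L(2) j(1) i(1)] by simp
    qed
    have len: "length ?E = length L" by simp
    show "\<exists>!i. i < length ?E \<and> g \<in> monomial_cell (fst (?E ! i)) (snd (?E ! i))"
      unfolding len
    proof (rule ex1I[of _ i])
      show "i < length L \<and> g \<in> monomial_cell (fst (?E ! i)) (snd (?E ! i))"
        unfolding cell[OF i(1)] i(2) using i(1) kP(2) by blast
      fix j assume "j < length L \<and> g \<in> monomial_cell (fst (?E ! j)) (snd (?E ! j))"
      then have "j < length L" "Poly_Mapping.lookup g \<in> cell (L ! j)" using cell[of j g] by blast+
      then show "j = i" by (rule uniq)
    qed
  next
    fix a Z assume "(a, Z) \<in> set ?E"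
    then obtain a' where a': "(a', Z) \<in> P" "a = exponent a'" using L(1) by auto
    show "monomial_cell a Z \<subseteq> basis"
    proof
      fix g assume "g \<in> monomial_cell a Z"
      then have "Poly_Mapping.lookup g \<in> cell (a', Z)" by (simp add: monomial_cell_def a'(2))
      then have "Poly_Mapping.lookup g \<in> E"
        using partitions_cell_subset[OF P(2) a'(1)] by blast
      then show "g \<in> basis" using E_iff by simp
    qed
  qed
  moreover have "d \<le> sdepth_decomp ?D"
  proof -
    have "P \<noteq> {}"
    proof
      assume "P = {}"
      moreover obtain b where "b \<in> E" using ne by blast
      ultimately show False using partitions_singleton[OF P(2), of b] by (simp add: is_singleton_def)
    qed
    then have ne: "set ?D \<noteq> {}" using L(1) by auto
    have "d \<le> card Z" if mZ: "(m, Z) \<in> set ?D" for m Z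
    proof -
      obtain a where "(a, Z) \<in> P" using mZ L(1) by auto
      then have "card (- Z) \<le> CARD('n) - d" using P(3) by blast
      moreover have "card (- Z) = CARD('n) - card Z" by (simp add: Compl_eq_Diff_UNIV card_Diff_subset)
      moreover have "card Z \<le> CARD('n)" by (rule card_mono) auto
      ultimately show ?thesis using d by simp
    qed
    then have "d \<le> (\<lambda>(m, Z). card Z) mZ" if "mZ \<in> set ?D" for mZ
      using that by (cases mZ) (simp only: prod.case)
    then have "d \<le> k" if "k \<in> (\<lambda>(m, Z). card Z) ` set ?D" for k
      using that by (elim imageE) (simp only:)
    then show ?thesis unfolding sdepth_decomp_def
      by (rule Min.boundedI[rotated 2]) (use ne in simp_all)
  qed
  ultimately have "stanley_decomposition Q G ?D" "sdepth_decomp ?D = d" using le[of ?D] by auto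
  then have mem: "d \<in> {sdepth_decomp D | D. stanley_decomposition Q G D}" by blast
  have bd: "k \<le> d" if "k \<in> {sdepth_decomp D | D. stanley_decomposition Q G D}" for k
    using that le by blast
  show ?thesis unfolding sdepth_def
  proof (rule Max_eqI)
    show "finite {sdepth_decomp D | D. stanley_decomposition Q G D}"
      by (rule finite_subset[of _ "{..d}"]) (use bd in auto)
  qed (fact bd, fact mem)
qed

theorem theorem2p9:
  fixes us vs :: "('n::finite, 'k::field) mpoly list"
    and p q :: nat
    and I J :: "('n, 'k) mpoly set"
  assumes "0 < p" and "p \<le> q"
    and "length us = q" and "length vs = p"
    and "\<forall>u\<in>set us. is_monomial u" and "\<forall>v\<in>set vs. is_monomial v"
    and "regular_sequence (ideal_module UNIV) us"
    and "regular_sequence (ideal_module UNIV) vs"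
    and "\<forall>i<p. us ! i dvd vs ! i"
    and "J = genideal ring_of_type_algebra (set us)"
    and "I = genideal ring_of_type_algebra (set vs)"
    and "I \<noteq> J"
    and "regular_sequence (ideal_quot UNIV I) (drop p us)"
  shows "int (sdepth (ideal_quot J I) (ideal_quot_grading J I)) =
    int CARD('n) - int p - \<lfloor>real (q - p) / 2\<rfloor>"
proof -
  obtain as where as: "us = map monomial as" using monomials_map[OF assms(5)] .
  obtain bs where bs: "vs = map monomial bs" using monomials_map[OF assms(6)] .
  have len: "length as = q" "length bs = p" using assms(3,4) as bs by auto
  have J: "J = monomial_span (multiples (set as))"
    using genideal_monomials[of "set as"] by (simp add: assms(10) as)
  have I: "I = monomial_span (multiples (set bs))"
    using genideal_monomials[of "set bs"] by (simp add: assms(11) bs)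
  have le: "Poly_Mapping.lookup (as ! i) \<le> Poly_Mapping.lookup (bs ! i)" if "i < p" for i
  proof (rule monomial_dvd_imp_le)
    show "monomial (as ! i) dvd (monomial (bs ! i) :: ('n, 'k) mpoly)"
      using assms(2,9) that len by (simp add: as bs)
  qed
  let ?a = "\<lambda>i. Poly_Mapping.lookup (as ! i)" and ?e = "\<lambda>i. Poly_Mapping.lookup ((bs @ drop p as) ! i)"
  interpret D: divided_disjoint_monomials ?a ?e p q
    by (rule regular_imp_divided_disjoint[OF assms(2) len])
      (use assms(7,8,13) le in \<open>simp_all add: as bs I drop_map\<close>)
  have sub: "multiples (set bs) \<subseteq> multiples (set as)"
  proof
    fix g assume "g \<in> multiples (set bs)"
    then obtain l where l: "l < p" "Poly_Mapping.lookup (bs ! l) \<le> Poly_Mapping.lookup g"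
      using len by (auto simp: multiples_set_iff)
    have "?a l \<le> Poly_Mapping.lookup g" using le[OF l(1)] l(2) by (rule order_trans)
    moreover have "l < length as" using l(1) assms(2) len by simp
    ultimately show "g \<in> multiples (set as)" unfolding multiples_set_iff by blast
  qed
  interpret monomial_quotient I J "set as" "set bs"
  proof (intro monomial_quotient.intro ideal_pair.intro monomial_quotient_axioms.intro)
    show "ideal I ring_of_type_algebra" "ideal J ring_of_type_algebra"
      unfolding I J by (rule monomial_span_ideal)+
    show "I \<subseteq> J" unfolding I J monomial_span_def using sub by auto
  qed (rule I J)+
  have basis: "g \<in> basis \<longleftrightarrow> Poly_Mapping.lookup g \<in> D.exponents" for g
  proof -
    have "?e i = Poly_Mapping.lookup (bs ! i)" if "i < p" for i using that len by (simp add: nth_append)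
    then show ?thesis unfolding basis_def D.exponents_def by (auto simp: multiples_set_iff len)
  qed
  have "D.exponents \<noteq> {}"
  proof
    assume "D.exponents = {}"
    then have "basis = {}" using basis by auto
    then have "J \<subseteq> I" unfolding I_eq J_eq monomial_span_def basis_def by auto
    then show False using IJ assms(12) by blast
  qed
  note dec = D.exponents_decomposable and bound = D.partition_bound[OF _ _ this]
  let ?d = "CARD('n) - (p + (q - p) div 2)"
  have n: "p + (q - p) div 2 \<le> CARD('n)"
  proof -
    obtain P where "finite P" "partitions P D.exponents" using dec unfolding cell_decomposable_def by blast
    then show ?thesis using bound[of P 0] by simp
  qed
  have "sdepth Q G = ?d"
  proof (rule sdepth_eq[OF basis \<open>D.exponents \<noteq> {}\<close>])
    show "cell_decomposable UNIV D.exponents (CARD('n) - ?d)" using dec n by simp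
    show "s \<le> ?d" if "finite P" "partitions P D.exponents" "\<And>c. c \<in> P \<Longrightarrow> s \<le> card (snd c)" for P s
      using bound[OF that] by simp
  qed simp
  moreover have "\<lfloor>real (q - p) / 2\<rfloor> = int ((q - p) div 2)"
    using floor_divide_of_nat_eq[of "q - p" 2] by simp
  ultimately show ?thesis using n by simp
qed

end
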